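(* Let $Q\subset\mathbb{C}$ be an unshielded continuum with finest map $\varphi$ onto a locally connected continuum, and let $X\subset Q$ be a continuum. If $X$ has a well-slicing family $\mathcal C$, then $\varphi(X)$ is not a point.
   Context: $Q$ is unshielded if $Q=\partial U_\infty$, $U_\infty$ the component of $\widehat{\mathbb{C}}\setminus Q$ containing $\infty$. Let $\Psi:\widehat{\mathbb{C}}\setminus\overline{\mathbb{D}}\to U_\infty$ be the Riemann map with $\Psi(\infty)=\infty$, $\Psi'(\infty)>0$. For an angle $\theta\in\mathbb{R}/\mathbb{Z}$: external ray $R_\theta=\Psi(\{re^{2\pi i\theta}:r>1\})$; principal set $\mathrm{acc}(\theta)$ = set of accumulation points of $\Psi(re^{2\pi i\theta})$ as $r\to1$; impression $\mathrm{imp}(\theta)$ = set of limits $\lim\Psi(z_i)$, $|z_i|>1$, $z_i\to e^{2\pi i\theta}$. The finest map $\varphi$ is the monotone surjection of $Q$ onto a locally connected continuum through which every other monotone surjection of $Q$ onto a locally connected continuum factors via a monotone map. A ray-compactum is a compactum $C\subset Q$ together with a closed set of angles $\Theta(C)$ such that $\bigcup_{\theta\in\Theta(C)}\mathrm{acc}(\theta)\subset C\subset\bigcup_{\theta\in\Theta(C)}\mathrm{imp}(\theta)$; set $\widetilde C=C\cup\bigcup_{\theta\in\Theta(C)}R_\theta$. $C$ ray-separates $A,B\subset Q$ if $\widetilde C$ separates $\overline{U_\infty}$ between $A$ and $B$ (i.e. $\overline{U_\infty}\setminus\widetilde C=U\cup V$ with $A\subset U$, $B\subset V$, $\overline U\cap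 V=U\cap\overline V=\emptyset$); $C$ ray-separates a continuum $X$ if it ray-separates two points of $X$. A well-slicing family for $X$ is a collection $\mathcal C$ of at least two pairwise disjoint ray-compacta in $Q$, each of which ray-separates $X$, such that any two distinct elements of $\mathcal C$ are ray-separated by a third element of $\mathcal C$. *)

theory Defs
  imports "HOL-Analysis.Analysis"
begin

definition continuum :: "'a::metric_space set \<Rightarrow> bool" where
  "continuum S \<longleftrightarrow> S \<noteq> {} \<and> compact S \<and> connected S"

(* U_infinity (finite part) = outside Q; unshielded: Q = boundary of U_infinity *)
definition unshielded :: "complex set \<Rightarrow> bool" where
  "unshielded Q \<longleftrightarrow> Q = frontier (outside Q)"

(* Psi is the normalised Riemann map of the exterior of the closed unit disk onto U_infinity:
   Psi(infinity) = infinity and Psi'(infinity) > 0, i.e. Psi z / z tends to a positive real *)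
definition riemann_map_ext :: "complex set \<Rightarrow> (complex \<Rightarrow> complex) \<Rightarrow> bool" where
  "riemann_map_ext Q \<Psi> \<longleftrightarrow>
     \<Psi> holomorphic_on {z. 1 < cmod z} \<and>
     bij_betw \<Psi> {z. 1 < cmod z} (outside Q) \<and>
     (\<exists>c::real. c > 0 \<and> ((\<lambda>z. \<Psi> z / z) \<longlongrightarrow> complex_of_real c) at_infinity)"

(* angles theta in R/Z are represented by reals; sets of angles by 1-periodic subsets of R *)
definition angle_set :: "real set \<Rightarrow> bool" where
  "angle_set \<Theta> \<longleftrightarrow> (\<forall>t. t \<in> \<Theta> \<longleftrightarrow> t + 1 \<in> \<Theta>)"

definition ext_ray :: "(complex \<Rightarrow> complex) \<Rightarrow> real \<Rightarrow> complex set" where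
  "ext_ray \<Psi> \<theta> = (\<lambda>r. \<Psi> (complex_of_real r * cis (2 * pi * \<theta>))) ` {r. 1 < r}"

definition acc_set :: "(complex \<Rightarrow> complex) \<Rightarrow> real \<Rightarrow> complex set" where
  "acc_set \<Psi> \<theta> = {w. \<forall>U. open U \<and> w \<in> U \<longrightarrow>
       (\<exists>\<^sub>F r in at_right 1. \<Psi> (complex_of_real r * cis (2 * pi * \<theta>)) \<in> U)}"

definition impression :: "(complex \<Rightarrow> complex) \<Rightarrow> real \<Rightarrow> complex set" where
  "impression \<Psi> \<theta> = {w. \<exists>z::nat \<Rightarrow> complex. (\<forall>i. 1 < cmod (z i)) \<and>
       z \<longlonglongrightarrow> cis (2 * pi * \<theta>) \<and> (\<lambda>i. \<Psi> (z i)) \<longlonglongrightarrow> w}"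

definition monotone_onto :: "('a::topological_space \<Rightarrow> 'b::topological_space) \<Rightarrow> 'a set \<Rightarrow> 'b set \<Rightarrow> bool" where
  "monotone_onto f A B \<longleftrightarrow> continuous_on A f \<and> f ` A = B \<and>
     (\<forall>y\<in>B. connected {x\<in>A. f x = y})"

definition lc_continuum :: "'a::metric_space set \<Rightarrow> bool" where
  "lc_continuum S \<longleftrightarrow> continuum S \<and> locally connected S"

(* finest map: monotone surjection onto a locally connected continuum Y through which every
   monotone surjection of Q onto a locally connected continuum Z factors via a monotone map.
   Z ranges over subsets of the Hilbert-cube-like space nat => real (product metric), in which every
   metric continuum embeds. *)
definition finest_map :: "complex set \<Rightarrow> (complex \<Rightarrow> 'a::metric_space) \<Rightarrow> 'a set \<Rightarrow> bool" where
  "finest_map Q \<phi> Y \<longleftrightarrow> lc_continuum Y \<and> monotone_onto \<phi> Q Y \<and>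
     (\<forall>(Z::(nat \<Rightarrow> real) set) (\<psi>::complex \<Rightarrow> (nat \<Rightarrow> real)).
        lc_continuum Z \<and> monotone_onto \<psi> Q Z \<longrightarrow>
        (\<exists>h. monotone_onto h Y Z \<and> (\<forall>x\<in>Q. \<psi> x = h (\<phi> x))))"

definition ray_compactum :: "complex set \<Rightarrow> (complex \<Rightarrow> complex) \<Rightarrow> complex set \<times> real set \<Rightarrow> bool" where
  "ray_compactum Q \<Psi> CT \<longleftrightarrow> (case CT of (C, \<Theta>) \<Rightarrow>
     compact C \<and> C \<subseteq> Q \<and> closed \<Theta> \<and> angle_set \<Theta> \<and>
     (\<Union>\<theta>\<in>\<Theta>. acc_set \<Psi> \<theta>) \<subseteq> C \<and> C \<subseteq> (\<Union>\<theta>\<in>\<Theta>. impression \<Psi> \<theta>))"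

definition ray_tilde :: "(complex \<Rightarrow> complex) \<Rightarrow> complex set \<times> real set \<Rightarrow> complex set" where
  "ray_tilde \<Psi> CT = fst CT \<union> (\<Union>\<theta>\<in>snd CT. ext_ray \<Psi> \<theta>)"

definition ray_separates :: "complex set \<Rightarrow> (complex \<Rightarrow> complex) \<Rightarrow> complex set \<times> real set
     \<Rightarrow> complex set \<Rightarrow> complex set \<Rightarrow> bool" where
  "ray_separates Q \<Psi> CT A B \<longleftrightarrow> (\<exists>U V.
     closure (outside Q) - ray_tilde \<Psi> CT = U \<union> V \<and> A \<subseteq> U \<and> B \<subseteq> V \<and>
     closure U \<inter> V = {} \<and> U \<inter> closure V = {})"

definition ray_separates_continuum :: "complex set \<Rightarrow> (complex \<Rightarrow> complex) \<Rightarrow> complex set \<times> real set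
     \<Rightarrow> complex set \<Rightarrow> bool" where
  "ray_separates_continuum Q \<Psi> CT X \<longleftrightarrow>
     (\<exists>x\<in>X. \<exists>y\<in>X. ray_separates Q \<Psi> CT {x} {y})"

definition well_slicing :: "complex set \<Rightarrow> (complex \<Rightarrow> complex) \<Rightarrow> (complex set \<times> real set) set
     \<Rightarrow> complex set \<Rightarrow> bool" where
  "well_slicing Q \<Psi> \<C> X \<longleftrightarrow>
     (\<exists>c1\<in>\<C>. \<exists>c2\<in>\<C>. c1 \<noteq> c2) \<and>
     (\<forall>c\<in>\<C>. ray_compactum Q \<Psi> c \<and> ray_separates_continuum Q \<Psi> c X) \<and>
     (\<forall>c1\<in>\<C>. \<forall>c2\<in>\<C>. c1 \<noteq> c2 \<longrightarrow> fst c1 \<inter> fst c2 = {}) \<and>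
     (\<forall>c1\<in>\<C>. \<forall>c2\<in>\<C>. c1 \<noteq> c2 \<longrightarrow>
        (\<exists>c3\<in>\<C>. c3 \<noteq> c1 \<and> c3 \<noteq> c2 \<and> ray_separates Q \<Psi> c3 (fst c1) (fst c2)))"

end

theory Submission
  imports Defs
begin

text \<open>
  It suffices to find a continuous \<open>f : Q \<rightarrow> [0,1]\<close> that is constant on every impression but not on
  \<open>X\<close>. The space of components of level sets of such an \<open>f\<close> is a monotone image of \<open>Q\<close> on which
  impressions (being connected) collapse to points, so it is a continuous image of the circle of
  angles and hence locally connected; therefore it factors through \<open>\<phi>\<close>, and \<open>\<phi>\<close> is not constant on \<open>X\<close>.

  The function \<open>f\<close> comes from the construction in Urysohn's lemma: between two nested cuts along
  members of the well-slicing family there is a third one. An impression can cross a ray-compactum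
  only if its angle belongs to it, and distinct members have no angle in common, because the
  nonempty principal set of such an angle would lie in both. As there are infinitely many cuts
  between two values of \<open>f\<close>, no impression can contain both values. Finally \<open>X\<close> is connected and
  separated by every member, so it meets the first and the last one, where \<open>f\<close> is 0 and 1.
\<close>

section \<open>Urysohn functions and monotone-light factorization\<close>

lemma dyadics_dense_unit_interval:
  fixes s t :: real
  assumes "0 \<le> s" "s < t" "t \<le> 1"
  obtains q where "q \<in> dyadics \<inter> {0..1}" "s < q" "q < t"
proof -
  obtain n m k where "real m / 2^n \<le> s" "s < real k / 2^n" "\<bar>real m / 2^n - real k / 2^n\<bar> < t - s"
    by (rule padic_rational_approximation_straddle_pos_le[of "t - s" 2 s]) (use assms in auto)
  moreover from this have "real k / 2^n < t"
    by linarith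
  moreover have "real k / 2^n \<in> dyadics"
    by (auto simp: dyadics_def)
  ultimately show thesis
    using assms by (intro that[of "real k / 2^n"]) (auto simp del: divide_le_eq_1 divide_le_eq_1_pos)
qed

text \<open>As in Urysohn's lemma, the value at \<open>x\<close> is the infimum of the levels
  \<open>q\<close> with \<open>x \<in> G q\<close>, capped by 1. Strict sublevel sets are unions of
  the open \<open>G q\<close>, strict superlevel sets are unions of the complements of the closed
  \<open>F q\<close>. The last two conclusions let a set on which \<open>f\<close> varies be
  compared with the cuts at intermediate levels.\<close>

lemma Urysohn_function_of_dyadic_chain:
  fixes Q :: "'a::topological_space set" and G F :: "real \<Rightarrow> 'a set"
  assumes openG: "\<And>q. q \<in> dyadics \<inter> {0..1} \<Longrightarrow> openin (top_of_set Q) (G q)"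
    and closedF: "\<And>q. q \<in> dyadics \<inter> {0..1} \<Longrightarrow> closedin (top_of_set Q) (F q)"
    and GF: "\<And>q. q \<in> dyadics \<inter> {0..1} \<Longrightarrow> G q \<subseteq> F q"
    and FG: "\<And>p q. \<lbrakk>p \<in> dyadics \<inter> {0..1}; q \<in> dyadics \<inter> {0..1}; p < q\<rbrakk> \<Longrightarrow> F p \<subseteq> G q"
  obtains f :: "'a \<Rightarrow> real" where "continuous_on Q f" "\<And>x. 0 \<le> f x" "\<And>x. f x \<le> 1"
    "\<And>x. x \<in> F 0 \<Longrightarrow> f x = 0" "\<And>x. x \<notin> G 1 \<Longrightarrow> f x = 1"
    "\<And>x q. \<lbrakk>q \<in> dyadics \<inter> {0..1}; f x < q\<rbrakk> \<Longrightarrow> x \<in> G q"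
    "\<And>x q. \<lbrakk>q \<in> dyadics \<inter> {0..1}; q < f x\<rbrakk> \<Longrightarrow> x \<notin> F q"
proof -
  define D where "D = (dyadics \<inter> {0..1} :: real set)"
  \<comment> \<open>The inserted 1 keeps the set nonempty and is the value at points that lie in no
    \<open>G r\<close>.\<close>
  define f where "f x = Inf (insert 1 {r \<in> D. x \<in> G r})" for x
  have bdd: "bdd_below (insert 1 {r \<in> D. x \<in> G r})" for x
    by (rule bdd_belowI[of _ 0]) (auto simp: D_def)
  have f_ge: "0 \<le> f x" for x
    unfolding f_def by (rule cInf_greatest) (auto simp: D_def)
  have f_le: "f x \<le> 1" for x
    unfolding f_def by (rule cInf_lower[OF _ bdd]) auto
  have in_G: "f x \<le> q" if "q \<in> D" "x \<in> G q" for x q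
    unfolding f_def by (rule cInf_lower[OF _ bdd]) (use that in auto)
  have less: "x \<in> G q" if q: "q \<in> D" "f x < q" for x q
  proof -
    obtain r where "r \<in> insert 1 {r \<in> D. x \<in> G r}" "r < q"
      using q(2) unfolding f_def using cInf_less_iff[OF _ bdd, of x q] by auto
    then have "r \<in> D" "x \<in> G r"
      using q(1) by (auto simp: D_def)
    then show ?thesis
      using FG[of r q] GF[of r] q(1) \<open>r < q\<close> by (auto simp: D_def)
  qed
  have greater: "x \<notin> F q" if q: "q \<in> D" "q < f x" for x q
  proof
    assume "x \<in> F q"
    \<comment> \<open>A level strictly between is needed because the chain gives
      \<open>F q \<subseteq> G r\<close> only for \<open>q < r\<close>.\<close>
    obtain r where r: "r \<in> dyadics \<inter> {0..1}" "q < r" "r < f x"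
      using dyadics_dense_unit_interval[of q "f x"] q f_le[of x] by (auto simp: D_def)
    then have "x \<in> G r"
      using FG[of q r] \<open>x \<in> F q\<close> q(1) by (auto simp: D_def)
    then show False
      using in_G[of r x] r by (auto simp: D_def)
  qed
  have notin_F: "q \<le> f x" if "q \<in> D" "x \<notin> F q" for x q
    using less[of q x] GF[of q] that by (force simp: D_def)
  have upper: "openin (top_of_set Q) {x \<in> Q. f x < a}" for a
  proof (cases "a > 1")
    case True
    then have "{x \<in> Q. f x < a} = Q"
      using f_le le_less_trans by blast
    then show ?thesis
      by simp
  next
    case False
    have "\<exists>q\<in>D. q < a \<and> x \<in> G q" if fx: "f x < a" for x
    proof -
      obtain q where "q \<in> dyadics \<inter> {0..1}" "f x < q" "q < a"
        using dyadics_dense_unit_interval[of "f x" a] f_ge fx False by auto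
      then show ?thesis
        using less[of q x] by (auto simp: D_def)
    qed
    moreover have "G q \<subseteq> Q" if "q \<in> D" for q
      using openG[of q] openin_subset[of "top_of_set Q" "G q"] that by (auto simp: D_def)
    moreover have "f x < a" if "q \<in> D" "q < a" "x \<in> G q" for q x
      using in_G[of q x] that by simp
    ultimately have "{x \<in> Q. f x < a} = (\<Union>q\<in>{q\<in>D. q < a}. G q)"
      by blast
    then show ?thesis
      using openG by (auto simp: D_def)
  qed
  have lower: "openin (top_of_set Q) {x \<in> Q. f x > a}" for a
  proof (cases "a < 0")
    case True
    then have "{x \<in> Q. f x > a} = Q"
      using f_ge less_le_trans by blast
    then show ?thesis
      by simp
  next
    case False
    have "\<exists>q\<in>D. q > a \<and> x \<notin> F q" if fx: "f x > a" for x
    proof -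
      obtain q where "q \<in> dyadics \<inter> {0..1}" "a < q" "q < f x"
        using dyadics_dense_unit_interval[of a "f x"] f_le fx False by auto
      then show ?thesis
        using greater[of q x] by (auto simp: D_def)
    qed
    moreover have "f x > a" if "q \<in> D" "q > a" "x \<notin> F q" for q x
      using notin_F[of q x] that by simp
    ultimately have "{x \<in> Q. f x > a} = (\<Union>q\<in>{q\<in>D. q > a}. Q - F q)"
      by blast
    moreover have "openin (top_of_set Q) (Q - F q)" if "q \<in> D" for q
      using closedF[of q] that by (auto simp: D_def closedin_def)
    ultimately show ?thesis
      by (simp only:) (rule openin_Union, blast)
  qed
  have "continuous_on Q f"
    using upper lower
    by (simp add: continuous_map_upper_lower_semicontinuous_lt flip: continuous_map_iff_continuous)
  moreover have "f x = 0" if "x \<in> F 0" for x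
    using greater[of 0 x] f_ge[of x] that real_in_dyadics[of 0] by (force simp: D_def)
  moreover have "f x = 1" if "x \<notin> G 1" for x
    using less[of 1 x] f_le[of x] that real_in_dyadics[of 1] by (force simp: D_def)
  ultimately show thesis
    using that[of f] f_ge f_le less greater by (simp add: D_def)
qed

text \<open>A relatively clopen set is compact, so finitely many members of a countable base already
  cut it out of \<open>S\<close>, and a countable base has only countably many finite
  subfamilies.\<close>

lemma countable_clopen_subsets_compact:
  fixes S :: "'a::{second_countable_topology,t2_space} set"
  assumes "compact S"
  shows "countable {A. openin (top_of_set S) A \<and> closedin (top_of_set S) A}"
proof -
  obtain B :: "'a set set" where B: "countable B" "\<And>b. b \<in> B \<Longrightarrow> open b"
      "\<And>U. open U \<Longrightarrow> \<exists>B'\<subseteq>B. U = \<Union>B'"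
    by (metis univ_second_countable)
  have "A \<in> (\<lambda>E. S \<inter> \<Union>E) ` {E. finite E \<and> E \<subseteq> B}"
    if A: "openin (top_of_set S) A" "closedin (top_of_set S) A" for A
  proof -
    obtain U where U: "open U" "A = S \<inter> U"
      using A(1) by (meson openin_open)
    obtain B' where B': "B' \<subseteq> B" "U = \<Union>B'"
      using B(3) U(1) by metis
    have "compact A"
      using closedin_compact[OF assms A(2)] .
    then obtain E where "E \<subseteq> B'" "finite E" "A \<subseteq> \<Union>E"
      using compactE[of A B'] U(2) B' B(2) by (metis Int_lower2 subsetD)
    then have "A = S \<inter> \<Union>E"
      using U(2) B'(2) by blast
    then show ?thesis
      using \<open>E \<subseteq> B'\<close> \<open>finite E\<close> B'(1) by blast
  qed
  then have "{A. openin (top_of_set S) A \<and> closedin (top_of_set S) A}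
      \<subseteq> (\<lambda>E. S \<inter> \<Union>E) ` {E. finite E \<and> E \<subseteq> B}"
    by blast
  then show ?thesis
    by (rule countable_subset) (intro countable_image countable_Collect_finite_subset B(1))
qed

text \<open>The components of \<open>x\<close> in the bands of half-width \<open>e\<close> are
  compact, connected and nested. Their intersection is therefore connected; it contains
  \<open>x\<close> and \<open>y\<close>, and \<open>f\<close> equals \<open>f x\<close> on
  it.\<close>

lemma connected_component_level_set:
  fixes f :: "'a::euclidean_space \<Rightarrow> real"
  assumes Q: "compact Q" and f: "continuous_on Q f" and "x \<in> Q"
    and cc: "\<And>e. e > 0 \<Longrightarrow> connected_component {z\<in>Q. f x - e \<le> f z \<and> f z \<le> f x + e} x y"
  shows "connected_component {z\<in>Q. f z = f x} x y"
proof -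
  define L where "L e = {z\<in>Q. f x - e \<le> f z \<and> f z \<le> f x + e}" for e
  define K where "K e = connected_component_set (L e) x" for e
  have L: "compact (L e)" for e
  proof -
    have "L e = Q \<inter> f -` {f x - e..f x + e}"
      by (auto simp: L_def)
    then show ?thesis
      using continuous_closedin_preimage[OF f, of "{f x - e..f x + e}"] closedin_compact[OF Q] by auto
  qed
  have mono: "K d \<subseteq> K e" if "d \<le> e" for d e
    unfolding K_def by (rule connected_component_mono) (use that in \<open>auto simp: L_def\<close>)
  have comp: "compact (K e)" for e
    unfolding K_def by (metis L compact_components componentsI compact_empty connected_component_eq_empty)
  have "connected (\<Inter>(K ` {0<..}))"
  proof (rule connected_chain_gen[of "K 1"])
    show "\<And>T. T \<in> K ` {0<..} \<Longrightarrow> closed T \<and> connected T"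
      using comp compact_imp_closed by (auto simp: K_def)
    show "\<And>S T. S \<in> K ` {0<..} \<and> T \<in> K ` {0<..} \<Longrightarrow> S \<subseteq> T \<or> T \<subseteq> S"
      using mono by (metis imageE linear)
  qed (use comp in auto)
  moreover have "\<Inter>(K ` {0<..}) \<subseteq> {z\<in>Q. f z = f x}"
  proof
    fix z assume z: "z \<in> \<Inter>(K ` {0<..})"
    have "z \<in> L e" if "e > 0" for e
      using z that connected_component_subset[of "L e" x] by (auto simp: K_def)
    then have "z \<in> Q" "\<And>e. e > 0 \<Longrightarrow> f x \<le> f z + e" "\<And>e. e > 0 \<Longrightarrow> f z \<le> f x + e"
      by (auto simp: L_def algebra_simps dest: spec[of _ 1] intro: zero_less_one)
    then show "z \<in> {z\<in>Q. f z = f x}"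
      using field_le_epsilon[of "f x" "f z"] field_le_epsilon[of "f z" "f x"] by force
  qed
  moreover have "x \<in> \<Inter>(K ` {0<..})" "y \<in> \<Inter>(K ` {0<..})"
    using cc \<open>x \<in> Q\<close> by (auto simp: K_def L_def connected_component_refl)
  ultimately show ?thesis
    unfolding connected_component_def by blast
qed

text \<open>The map lists countably many real functions, one for each rational band
  \<open>L a b\<close> and each clopen piece \<open>A\<close> of it: the bump
  \<open>(f - a) * (b - f)\<close> on \<open>A\<close> and 0 elsewhere. Clopen pieces of compact
  bands tell components apart, and the bump vanishes at the ends of the band, so restricting it to a
  piece keeps it continuous. The target \<open>nat \<Rightarrow> real\<close> is the space over
  which the test maps of \<open>finest_map\<close> range.\<close>

lemma monotone_light_factorization:
  fixes f :: "'a::euclidean_space \<Rightarrow> real"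
  assumes Q: "compact Q" and f: "continuous_on Q f"
  obtains \<psi> :: "'a \<Rightarrow> nat \<Rightarrow> real" where "continuous_on Q \<psi>"
    "\<And>x y. \<lbrakk>x \<in> Q; y \<in> Q\<rbrakk> \<Longrightarrow> \<psi> x = \<psi> y \<longleftrightarrow> connected_component {z\<in>Q. f z = f x} x y"
proof -
  define L where "L a b = {z\<in>Q. a \<le> f z \<and> f z \<le> b}" for a b
  define clop where "clop a b = {A. openin (top_of_set (L a b)) A \<and> closedin (top_of_set (L a b)) A}" for a b
  define I where "I = (SIGMA a:\<rat>. SIGMA b:\<rat>. clop a b)"
  define g where "g = (\<lambda>(a, b, A) x. if x \<in> A then (f x - a) * (b - f x) else 0)"
  have compL: "compact (L a b)" for a b
  proof -
    have "L a b = Q \<inter> f -` {a..b}"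
      by (auto simp: L_def)
    then show ?thesis
      using continuous_closedin_preimage[OF f, of "{a..b}"] closedin_compact[OF Q] by auto
  qed
  have "countable I"
    unfolding I_def clop_def by (intro countable_SIGMA countable_rat countable_clopen_subsets_compact compL)
  moreover have "(0, 0, {}) \<in> I"
    by (auto simp: I_def clop_def)
  ultimately obtain e :: "nat \<Rightarrow> real \<times> real \<times> 'a set" where e: "range e = I"
    using uncountable_def by blast
  define \<psi> where "\<psi> x n = g (e n) x" for x n
  have eq_iff: "\<psi> x = \<psi> y \<longleftrightarrow> (\<forall>i\<in>I. g i x = g i y)" for x y
    unfolding \<psi>_def fun_eq_iff by (simp flip: e)
  have contg: "continuous_on Q (g (a, b, A))" if "A \<in> clop a b" for a b A
  proof -
    \<comment> \<open>\<open>A\<close> and \<open>B\<close> are closed, cover \<open>Q\<close>, and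
      meet only where \<open>f\<close> is \<open>a\<close> or \<open>b\<close>. The bump is 0 there,
      so the two definitions paste together.\<close>
    define B where "B = (L a b - A) \<union> (Q \<inter> f -` {..a}) \<union> (Q \<inter> f -` {b..})"
    have "closedin (top_of_set (L a b)) (L a b - A)"
      using that by (auto simp: clop_def)
    then have "closed B"
      unfolding B_def using continuous_closedin_preimage[OF f, of "{..a}"] continuous_closedin_preimage[OF f, of "{b..}"]
      by (meson Q closed_Un closed_atLeast closed_atMost closedin_compact compL compact_imp_closed)
    moreover have "closed A"
      using that compL closedin_compact compact_imp_closed unfolding clop_def by blast
    moreover have AL: "A \<subseteq> L a b"
      using that openin_subset unfolding clop_def by fastforce
    then have Q_eq: "Q = A \<union> B"
      by (auto simp: B_def L_def)
    moreover have "continuous_on A (\<lambda>x. (f x - a) * (b - f x))"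
      using continuous_on_subset[OF f] Q_eq by (intro continuous_intros) auto
    moreover have "(f x - a) * (b - f x) = 0" if "x \<in> B" "x \<in> A" for x
      using that AL by (auto simp: B_def L_def)
    ultimately have "continuous_on (A \<union> B) (\<lambda>x. if x \<in> A then (f x - a) * (b - f x) else 0)"
      by (intro continuous_on_cases) (auto intro: continuous_intros)
    then show ?thesis
      by (simp add: g_def Q_eq)
  qed
  have "continuous_on Q \<psi>"
  proof (rule continuous_on_coordinatewise_then_product)
    fix n
    have "e n \<in> I"
      using e by blast
    then show "continuous_on Q (\<lambda>x. \<psi> x n)"
      using contg by (auto simp: \<psi>_def I_def)
  qed
  moreover have "\<psi> x = \<psi> y \<longleftrightarrow> connected_component {z\<in>Q. f z = f x} x y" if x: "x \<in> Q" and y: "y \<in> Q" for x y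
  proof
    assume cc: "connected_component {z\<in>Q. f z = f x} x y"
    then obtain T where T: "connected T" "T \<subseteq> {z\<in>Q. f z = f x}" "x \<in> T" "y \<in> T"
      unfolding connected_component_def by blast
    then have fy: "f y = f x"
      by blast
    have "g (a, b, A) x = g (a, b, A) y" if "A \<in> clop a b" for a b A
    proof (cases "x \<in> L a b")
      case True
      then have "T \<subseteq> L a b"
        using T by (auto simp: L_def)
      moreover have "T \<subseteq> A \<or> disjnt T A"
        using connectedin_clopen_cases[of "top_of_set (L a b)" T A] that T(1) \<open>T \<subseteq> L a b\<close>
        by (auto simp: clop_def connectedin_subtopology)
      ultimately show ?thesis
        using T fy by (auto simp: g_def disjnt_iff)
    next
      case False
      moreover have "A \<subseteq> L a b"
        using that openin_subset unfolding clop_def by fastforce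
      ultimately show ?thesis
        using x y fy by (auto simp: g_def L_def)
    qed
    then show "\<psi> x = \<psi> y"
      by (auto simp: eq_iff I_def)
  next
    assume "\<psi> x = \<psi> y"
    then have sep: "g (a, b, A) x = g (a, b, A) y" if "A \<in> clop a b" "a \<in> \<rat>" "b \<in> \<rat>" for a b A
      using that by (auto simp: eq_iff I_def)
    \<comment> \<open>The whole band is a clopen piece of itself. With
      \<open>a < f u < b < f v\<close> its bump is positive at \<open>u\<close> and 0 at
      \<open>v\<close>, so equal coordinates force equal values of \<open>f\<close>.\<close>
    have not_less: "\<not> f u < f v" if uv: "u \<in> Q" "\<And>a b. \<lbrakk>a \<in> \<rat>; b \<in> \<rat>\<rbrakk> \<Longrightarrow> g (a, b, L a b) u = g (a, b, L a b) v" for u v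
    proof
      assume "f u < f v"
      then obtain a b where "a \<in> \<rat>" "b \<in> \<rat>" "a < f u" "f u < b" "b < f v"
        using Rats_dense_in_real[of "f u" "f v"] Rats_dense_in_real[of "f u - 1" "f u"] by auto
      then show False
        using uv(2)[of a b] uv(1) by (auto simp: g_def L_def)
    qed
    have "L a b \<in> clop a b" for a b
      by (simp add: clop_def)
    then have fxy: "f x = f y"
      using not_less[of x y] not_less[of y x] sep x y by force
    show "connected_component {z\<in>Q. f z = f x} x y"
    proof (rule connected_component_level_set[OF Q f x], rule ccontr)
      fix d :: real
      assume "d > 0"
      assume "\<not> connected_component {z\<in>Q. f x - d \<le> f z \<and> f z \<le> f x + d} x y"
      then have ncc: "\<not> connected_component (L (f x - d) (f x + d)) x y"
        by (simp add: L_def)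
      \<comment> \<open>Only rational bands are indexed, so one is squeezed between the level of
        \<open>x\<close> and the given band.\<close>
      obtain a b where ab: "a \<in> \<rat>" "b \<in> \<rat>" "f x - d < a" "a < f x" "f x < b" "b < f x + d"
        using Rats_dense_in_real[of "f x - d" "f x"] Rats_dense_in_real[of "f x" "f x + d"] \<open>d > 0\<close> by auto
      have "L a b \<subseteq> L (f x - d) (f x + d)"
        using ab by (auto simp: L_def)
      then have "y \<notin> connected_component_set (L a b) x"
        using ncc by (meson connected_component_mono mem_Collect_eq subsetD)
      moreover have xL: "x \<in> L a b"
        using ab x by (auto simp: L_def)
      \<comment> \<open>By Sura-Bura, a component of a compact set has arbitrarily small clopen
        neighbourhoods, so one of them excludes \<open>y\<close>.\<close>
      ultimately obtain A where A: "connected_component_set (L a b) x \<subseteq> A" "A \<in> clop a b" "y \<notin> A"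
        using Sura_Bura_compact[OF compL[of a b] componentsI[OF xL]] by (auto simp: clop_def)
      have "x \<in> A"
        using A(1) xL by (meson connected_component_refl mem_Collect_eq subsetD)
      then have "g (a, b, A) x > 0" "g (a, b, A) y = 0"
        using ab A(3) by (auto simp: g_def)
      then show False
        using sep[OF A(2) ab(1,2)] by simp
    qed
  qed
  ultimately show thesis
    by (rule that)
qed

section \<open>Impressions of the exterior Riemann map\<close>

locale exterior_map =
  fixes Q :: "complex set" and \<Psi> :: "complex \<Rightarrow> complex"
  assumes continuum_Q: "continuum Q" and unshielded_Q: "unshielded Q"
    and riemann_map: "riemann_map_ext Q \<Psi>"
begin

lemma compact_Q: "compact Q"
  using continuum_Q by (simp add: continuum_def)

lemma open_outside_Q: "open (outside Q)"
  by (simp add: compact_Q compact_imp_closed open_outside)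

lemma Q_eq: "Q = closure (outside Q) - outside Q"
  using unshielded_Q open_outside_Q by (metis unshielded_def frontier_def interior_open)

lemma inj_on_map: "inj_on \<Psi> {z. 1 < cmod z}"
  and image_map: "\<Psi> ` {z. 1 < cmod z} = outside Q"
  using riemann_map by (auto simp: riemann_map_ext_def bij_betw_def)

lemma map_in_outside: "1 < cmod z \<Longrightarrow> \<Psi> z \<in> outside Q"
  using image_map by blast

lemma map_notin_Q: "1 < cmod z \<Longrightarrow> \<Psi> z \<notin> Q"
  using map_in_outside Q_eq by blast

lemma open_exterior: "open {z. 1 < cmod z}"
  by (intro open_Collect_less continuous_intros)

lemma continuous_on_map: "continuous_on {z. 1 < cmod z} \<Psi>"
  using riemann_map by (auto simp: riemann_map_ext_def holomorphic_on_imp_continuous_on)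

text \<open>In the closure of this graph the fibre over a point of the unit circle is the impression
  of its angle, so all impressions are slices of a single closed set.\<close>

definition map_graph :: "(complex \<times> complex) set" where
  "map_graph = (\<lambda>z. (z, \<Psi> z)) ` {z. 1 < cmod z}"

lemma closure_map_graph_iff:
  "(a, w) \<in> closure map_graph \<longleftrightarrow>
    (\<exists>z. (\<forall>i. 1 < cmod (z i)) \<and> z \<longlonglongrightarrow> a \<and> (\<lambda>i::nat. \<Psi> (z i)) \<longlonglongrightarrow> w)" (is "?L \<longleftrightarrow> ?R")
proof
  assume ?L
  then obtain p where p: "\<And>i::nat. p i \<in> map_graph" "p \<longlonglongrightarrow> (a, w)"
    unfolding closure_sequential by blast
  have "1 < cmod (fst (p i)) \<and> snd (p i) = \<Psi> (fst (p i))" for i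
    using p(1)[of i] by (auto simp: map_graph_def)
  then show ?R
    using tendsto_fst[OF p(2)] tendsto_snd[OF p(2)] by (intro exI[of _ "\<lambda>i. fst (p i)"]) auto
next
  assume ?R
  then obtain z where "\<And>i. 1 < cmod (z i)" "z \<longlonglongrightarrow> a" "(\<lambda>i::nat. \<Psi> (z i)) \<longlonglongrightarrow> w"
    by blast
  then show ?L
    unfolding closure_sequential
    by (intro exI[of _ "\<lambda>i. (z i, \<Psi> (z i))"]) (auto simp: map_graph_def intro: tendsto_Pair)
qed

lemma impression_iff: "w \<in> impression \<Psi> \<theta> \<longleftrightarrow> (cis (2 * pi * \<theta>), w) \<in> closure map_graph"
  by (simp add: impression_def closure_map_graph_iff)

text \<open>Over the open exterior, continuity determines the limit. Over the unit circle, a limit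
  inside \<open>outside Q\<close> is impossible: by invariance of domain the inverse of
  \<open>\<Psi>\<close> is continuous and would pull the sequence back to a point of modulus above
  1. What remains is the boundary, which is \<open>Q\<close>.\<close>

lemma closure_map_graph_cases:
  assumes "(a, w) \<in> closure map_graph"
  shows "1 < cmod a \<and> w = \<Psi> a \<or> cmod a = 1 \<and> w \<in> Q"
proof -
  obtain z where z: "\<And>i::nat. 1 < cmod (z i)" "z \<longlonglongrightarrow> a" "(\<lambda>i. \<Psi> (z i)) \<longlonglongrightarrow> w"
    using assms closure_map_graph_iff by blast
  have "1 \<le> cmod a"
    by (rule tendsto_lowerbound[OF tendsto_norm[OF z(2)]]) (auto simp: less_imp_le z(1))
  moreover have "w = \<Psi> a" if "1 < cmod a"
  proof -
    have "isCont \<Psi> a"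
      using continuous_on_map open_exterior that by (simp add: continuous_on_eq_continuous_at)
    then have "(\<lambda>i. \<Psi> (z i)) \<longlonglongrightarrow> \<Psi> a"
      using z(2) isCont_tendsto_compose by blast
    then show ?thesis
      using z(3) LIMSEQ_unique by blast
  qed
  moreover have "w \<in> Q" if a: "cmod a = 1"
  proof -
    have "w \<in> closure (outside Q)"
      unfolding closure_sequential
      by (intro exI[of _ "\<lambda>i. \<Psi> (z i)"] conjI allI map_in_outside z)
    moreover have "w \<notin> outside Q"
    proof
      assume w: "w \<in> outside Q"
      obtain g where "homeomorphism {z. 1 < cmod z} (\<Psi> ` {z. 1 < cmod z}) \<Psi> g"
        using invariance_of_domain_homeomorphism[OF open_exterior continuous_on_map _ inj_on_map] by auto
      then have g: "continuous_on (outside Q) g" "\<And>y. 1 < cmod y \<Longrightarrow> g (\<Psi> y) = y" "1 < cmod (g w)"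
        using w unfolding homeomorphism_def image_map by auto
      have "isCont g w"
        using g(1) open_outside_Q w by (simp add: continuous_on_eq_continuous_at)
      then have "(\<lambda>i. g (\<Psi> (z i))) \<longlonglongrightarrow> g w"
        using z(3) isCont_tendsto_compose by blast
      then have "z \<longlonglongrightarrow> g w"
        using g(2) z(1) by simp
      then show False
        using z(2) LIMSEQ_unique g(3) a by fastforce
    qed
    ultimately show ?thesis
      using Q_eq by blast
  qed
  ultimately show ?thesis
    by force
qed

lemma impression_subset: "impression \<Psi> \<theta> \<subseteq> Q"
  using closure_map_graph_cases by (fastforce simp: impression_iff)

text \<open>Near infinity \<open>\<Psi> z / z\<close> stays within \<open>c / 2\<close> of its limit
  \<open>c > 0\<close>. Hence sequences with bounded image are bounded.\<close>

lemma map_linear_growth: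
  obtains M \<delta> where "M > 1" "\<delta> > 0" "\<And>z. M \<le> cmod z \<Longrightarrow> \<delta> * cmod z \<le> cmod (\<Psi> z)"
proof -
  obtain c :: real where c: "c > 0" "((\<lambda>z. \<Psi> z / z) \<longlongrightarrow> complex_of_real c) at_infinity"
    using riemann_map by (auto simp: riemann_map_ext_def)
  have "\<forall>\<^sub>F z in at_infinity. dist (\<Psi> z / z) (complex_of_real c) < c / 2"
    using c by (intro tendstoD) auto
  then obtain b where b: "\<And>z. b \<le> cmod z \<Longrightarrow> dist (\<Psi> z / z) (complex_of_real c) < c / 2"
    by (auto simp: eventually_at_infinity)
  have "c / 2 * cmod z \<le> cmod (\<Psi> z)" if "max b 2 \<le> cmod z" for z
  proof -
    have "cmod (complex_of_real c) \<le> cmod (\<Psi> z / z) + dist (\<Psi> z / z) (complex_of_real c)"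
      by (metis dist_commute dist_norm norm_triangle_sub)
    then have "c / 2 \<le> cmod (\<Psi> z / z)"
      using b[of z] that c(1) by auto
    moreover have "cmod z > 0"
      using that by auto
    ultimately show ?thesis
      by (simp add: norm_divide field_simps)
  qed
  then show thesis
    using that[of "max b 2" "c / 2"] c(1) by auto
qed

text \<open>In the coordinate \<open>1 / z\<close> the map extends continuously and injectively over infinity, so by
  invariance of domain its values near infinity are taken only near infinity.\<close>

lemma map_bounded_near_circle:
  obtains M where "M > 1" "bounded (\<Psi> ` {z. 1 < cmod z \<and> cmod z < M})"
proof -
  obtain M \<delta> where M: "M > 1" "\<delta> > 0" "\<And>z. M \<le> cmod z \<Longrightarrow> \<delta> * cmod z \<le> cmod (\<Psi> z)"
    using map_linear_growth by blast
  define g where "g w = (if w = 0 then 0 else inverse (\<Psi> (inverse w)))" for w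
  define S where "S = ball (0::complex) (1 / M)"
  have large: "M < cmod (inverse w)" if "w \<in> S" "w \<noteq> 0" for w
    using that M(1) by (simp add: S_def norm_inverse) (simp add: field_simps)
  have nz: "\<Psi> (inverse w) \<noteq> 0" if "w \<in> S" "w \<noteq> 0" for w
  proof -
    have "0 < \<delta> * cmod (inverse w)"
      using M(2) that by simp
    also have "\<dots> \<le> cmod (\<Psi> (inverse w))"
      using M(3) large[OF that] by simp
    finally show ?thesis
      by auto
  qed
  \<comment> \<open>Linear growth of \<open>\<Psi>\<close> turns into a linear bound at 0, which
    gives continuity at the added point.\<close>
  have g_bound: "cmod (g w) \<le> cmod w / \<delta>" if "w \<in> S" for w
  proof (cases "w = 0")
    case False
    have "\<delta> * cmod (inverse w) \<le> cmod (\<Psi> (inverse w))"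
      using M(3) large[OF that False] by simp
    then show ?thesis
      using False nz[OF that False] M(2) by (simp add: g_def norm_inverse) (simp add: field_simps)
  qed (simp add: g_def)
  have "isCont g w" if "w \<in> S" for w
  proof (cases "w = 0")
    case True
    have "(g \<longlongrightarrow> 0) (at 0)"
    proof (rule Lim_null_comparison)
      have "\<forall>\<^sub>F w in at 0. w \<in> S"
        using M(1) unfolding S_def by (intro eventually_at_in_open') auto
      then show "\<forall>\<^sub>F w in at 0. norm (g w) \<le> cmod w / \<delta>"
        by eventually_elim (rule g_bound)
      show "((\<lambda>w. cmod w / \<delta>) \<longlongrightarrow> 0) (at 0)"
        using M(2) by (intro tendsto_eq_intros) auto
    qed
    then show ?thesis
      using True by (simp add: isCont_def g_def)
  next
    case False
    have "isCont \<Psi> (inverse w)"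
      using continuous_on_map open_exterior large[OF that False] M(1)
      by (simp add: continuous_on_eq_continuous_at)
    then have "isCont (\<lambda>w. inverse (\<Psi> (inverse w))) w"
      using False nz[OF that False] by (intro continuous_intros isCont_o2[of w inverse \<Psi>]) auto
    moreover have "\<forall>\<^sub>F u in nhds w. g u = inverse (\<Psi> (inverse u))"
      using t1_space_nhds[OF False] by eventually_elim (simp add: g_def)
    ultimately show ?thesis
      by (simp add: isCont_cong)
  qed
  then have "continuous_on S g"
    by (simp add: continuous_at_imp_continuous_on)
  moreover have "inj_on g S"
  proof (rule inj_onI)
    fix u v assume uv: "u \<in> S" "v \<in> S" "g u = g v"
    show "u = v"
    proof (cases "u = 0 \<or> v = 0")
      case True
      then show ?thesis
        using uv nz by (auto simp: g_def split: if_splits)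
    next
      case False
      then have "\<Psi> (inverse u) = \<Psi> (inverse v)"
        using uv by (simp add: g_def)
      moreover have "1 < cmod (inverse u)" "1 < cmod (inverse v)"
        using large False uv M(1) by force+
      ultimately have "inverse u = inverse v"
        using inj_on_map by (auto dest: inj_onD)
      then show ?thesis
        by simp
    qed
  qed
  ultimately have "open (g ` S)"
    by (intro invariance_of_domain) (auto simp: S_def)
  moreover have "0 \<in> g ` S"
    using M(1) by (auto simp: g_def S_def intro!: image_eqI[of _ _ 0])
  ultimately obtain d where d: "d > 0" "ball 0 d \<subseteq> g ` S"
    by (meson open_contains_ball)
  \<comment> \<open>Every value of modulus above \<open>1 / d\<close> is already attained at some
    \<open>inverse w\<close> of modulus above \<open>M\<close>; by injectivity it cannot recur
    closer to the circle.\<close>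
  have "cmod (\<Psi> z) \<le> 1 / d" if z: "1 < cmod z" "cmod z < M" for z
  proof (rule ccontr)
    assume "\<not> cmod (\<Psi> z) \<le> 1 / d"
    then have big: "1 / d < cmod (\<Psi> z)"
      by simp
    then have "\<Psi> z \<noteq> 0"
      using d(1) by (auto simp: field_simps)
    moreover have "cmod (inverse (\<Psi> z)) < d"
      using big d(1) \<open>\<Psi> z \<noteq> 0\<close> by (simp add: norm_inverse) (simp add: field_simps)
    then obtain w where w: "w \<in> S" "inverse (\<Psi> z) = g w"
      using d(2) by (auto simp: subset_iff)
    ultimately have "w \<noteq> 0" "\<Psi> z = \<Psi> (inverse w)"
      by (auto simp: g_def split: if_splits)
    then have "z = inverse w"
      using inj_on_map z(1) large[OF w(1)] M(1) by (auto dest: inj_onD)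
    then show False
      using large[OF w(1)] z(2) \<open>w \<noteq> 0\<close> by simp
  qed
  then have "bounded (\<Psi> ` {z. 1 < cmod z \<and> cmod z < M})"
    by (auto intro!: boundedI)
  then show thesis
    using that M(1) by blast
qed

text \<open>A point of \<open>Q\<close> is a limit of values \<open>\<Psi> (z i)\<close>. Linear
  growth bounds the \<open>z i\<close>, and a subsequential limit must lie on the unit circle
  because \<open>\<Psi>\<close> takes no value in \<open>Q\<close>. The window
  \<open>{-1..1}\<close> is a compact stand-in for the circle of angles and contains
  \<open>Arg a / (2 * pi)\<close>.\<close>

lemma impressions_cover:
  assumes "w \<in> Q"
  obtains \<theta> where "\<theta> \<in> {-1..1}" "w \<in> impression \<Psi> \<theta>"
proof -
  obtain M \<delta> where M: "M > 1" "\<delta> > 0" "\<And>z. M \<le> cmod z \<Longrightarrow> \<delta> * cmod z \<le> cmod (\<Psi> z)"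
    using map_linear_growth by blast
  obtain y where y: "\<And>i::nat. y i \<in> outside Q" "y \<longlonglongrightarrow> w"
    using assms Q_eq closure_sequential[of w "outside Q"] by blast
  obtain z where z: "\<And>i. 1 < cmod (z i)" "\<And>i. \<Psi> (z i) = y i"
    using y(1) unfolding image_map[symmetric] image_iff by (metis mem_Collect_eq)
  obtain K where K: "\<And>i. cmod (y i) \<le> K"
    using convergent_imp_bounded[OF y(2)] by (auto simp: bounded_iff)
  have "cmod (z i) \<le> max M (K / \<delta>)" for i
  proof (cases "M \<le> cmod (z i)")
    case True
    then have "\<delta> * cmod (z i) \<le> K"
      using M(3) K[of i] z(2)[of i] by fastforce
    then show ?thesis
      using M(2) by (simp add: field_simps le_max_iff_disj)
  qed auto
  then have "bounded (range z)"
    by (auto intro!: boundedI)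
  then obtain a r where r: "strict_mono r" "(z \<circ> r) \<longlonglongrightarrow> a"
    using bounded_imp_convergent_subsequence by blast
  have "(\<lambda>i. \<Psi> ((z \<circ> r) i)) \<longlonglongrightarrow> w"
    using LIMSEQ_subseq_LIMSEQ[OF y(2) r(1)] z(2) by (simp add: o_def)
  then have cl: "(a, w) \<in> closure map_graph"
    unfolding closure_map_graph_iff using r(2) z(1) by (intro exI[of _ "z \<circ> r"]) auto
  then have "cmod a = 1"
    using closure_map_graph_cases assms map_notin_Q by blast
  then have "a = cis (2 * pi * (Arg a / (2 * pi)))"
    by (metis Arg_eq cis_conv_exp mult.commute mult_1 nonzero_mult_div_cancel_left of_real_1
        times_divide_eq_right norm_zero zero_neq_one pi_neq_zero mult_eq_0_iff zero_neq_numeral)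
  moreover have "Arg a / (2 * pi) \<in> {-1..1}"
    using Arg_bounded[of a] pi_gt_zero by (auto simp: field_simps)
  ultimately show thesis
    using that cl impression_iff by metis
qed

section \<open>Sectors, connectedness of impressions and accumulation along rays\<close>

definition sector :: "real \<Rightarrow> real \<Rightarrow> complex set" where
  "sector \<theta> \<epsilon> = (\<lambda>(r, t). complex_of_real r * cis (2 * pi * t)) ` ({1<..<1+\<epsilon>} \<times> {\<theta>-\<epsilon><..<\<theta>+\<epsilon>})"

lemma sector_subset: "sector \<theta> \<epsilon> \<subseteq> {z. 1 < cmod z \<and> cmod z < 1 + \<epsilon>}"
  by (auto simp: sector_def norm_mult)

lemma sector_mono: "\<epsilon> \<le> \<delta> \<Longrightarrow> sector \<theta> \<epsilon> \<subseteq> sector \<theta> \<delta>"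
  unfolding sector_def by (intro image_mono Sigma_mono) auto

lemma connected_sector_image: "connected (\<Psi> ` sector \<theta> \<epsilon>)"
proof -
  have "connected (sector \<theta> \<epsilon>)"
    unfolding sector_def case_prod_beta
    by (intro connected_continuous_image continuous_intros convex_connected convex_Times) auto
  then show ?thesis
    using sector_subset by (intro connected_continuous_image continuous_on_subset[OF continuous_on_map]) auto
qed

text \<open>Rotating by the angle moves the limit of the sequence to 1, where \<open>Arg\<close> is
  continuous. This yields polar angles tending to \<open>\<theta>\<close> itself and not merely
  modulo 1, so the sequence finally enters the sector.\<close>

lemma impression_subset_closure_sector:
  assumes "\<epsilon> > 0"
  shows "impression \<Psi> \<theta> \<subseteq> closure (\<Psi> ` sector \<theta> \<epsilon>)"
proof
  fix w assume "w \<in> impression \<Psi> \<theta>"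
  then obtain z where z: "\<And>i::nat. 1 < cmod (z i)" "z \<longlonglongrightarrow> cis (2 * pi * \<theta>)" "(\<lambda>i. \<Psi> (z i)) \<longlonglongrightarrow> w"
    by (auto simp: impression_def)
  define u where "u i = z i * cis (- (2 * pi * \<theta>))" for i
  define t where "t i = \<theta> + Arg (u i) / (2 * pi)" for i
  have "u \<longlonglongrightarrow> cis (2 * pi * \<theta>) * cis (- (2 * pi * \<theta>))"
    unfolding u_def by (intro tendsto_intros z(2))
  then have "u \<longlonglongrightarrow> 1"
    by (simp add: cis_mult)
  then have "(\<lambda>i. Arg (u i)) \<longlonglongrightarrow> Arg 1"
    by (intro isCont_tendsto_compose[OF continuous_at_Arg]) auto
  then have "t \<longlonglongrightarrow> \<theta> + 0 / (2 * pi)"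
    unfolding t_def by (intro tendsto_intros) auto
  then have "\<forall>\<^sub>F i in sequentially. t i \<in> {\<theta>-\<epsilon><..<\<theta>+\<epsilon>}"
    using assms by (intro topological_tendstoD) auto
  moreover have "(\<lambda>i. cmod (z i)) \<longlonglongrightarrow> 1"
    using tendsto_norm[OF z(2)] by simp
  then have "\<forall>\<^sub>F i in sequentially. cmod (z i) < 1 + \<epsilon>"
    using assms by (intro order_tendstoD) auto
  ultimately have "\<forall>\<^sub>F i in sequentially. \<Psi> (z i) \<in> closure (\<Psi> ` sector \<theta> \<epsilon>)"
  proof eventually_elim
    case (elim i)
    have "u i \<noteq> 0" "cmod (u i) = cmod (z i)"
      using z(1)[of i] by (auto simp: u_def norm_mult)
    then have "u i = complex_of_real (cmod (z i)) * cis (Arg (u i))"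
      by (metis Arg_eq cis_conv_exp)
    moreover have "z i = u i * cis (2 * pi * \<theta>)"
      by (simp add: u_def mult.assoc cis_mult)
    moreover have "Arg (u i) + 2 * pi * \<theta> = 2 * pi * t i"
      by (simp add: t_def field_simps)
    ultimately have "z i = complex_of_real (cmod (z i)) * cis (2 * pi * t i)"
      by (metis cis_mult mult.assoc)
    then have "z i \<in> sector \<theta> \<epsilon>"
      unfolding sector_def using elim z(1)[of i] by (intro image_eqI[of _ _ "(cmod (z i), t i)"]) auto
    then show ?case
      by (meson closure_subset imageI subsetD)
  qed
  then show "w \<in> closure (\<Psi> ` sector \<theta> \<epsilon>)"
    by (intro Lim_in_closed_set[OF closed_closure _ _ z(3)]) auto
qed

text \<open>The impression is the intersection of the closed images of shrinking sectors. These are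
  nested and connected, and compact from some index on because \<open>\<Psi>\<close> is bounded near
  the circle.\<close>

lemma connected_impression: "connected (impression \<Psi> \<theta>)"
proof -
  define S where "S n = closure (\<Psi> ` sector \<theta> (inverse (real (Suc n))))" for n
  have "impression \<Psi> \<theta> = \<Inter>(range S)"
  proof (intro subset_antisym subsetI)
    fix w assume w: "w \<in> \<Inter>(range S)"
    have "\<exists>r t. 1 < r \<and> r < 1 + inverse (real (Suc n)) \<and> \<bar>t - \<theta>\<bar> < inverse (real (Suc n)) \<and>
        dist (\<Psi> (complex_of_real r * cis (2 * pi * t))) w < inverse (real (Suc n))" for n
    proof -
      have "w \<in> closure (\<Psi> ` sector \<theta> (inverse (real (Suc n))))"
        using w by (auto simp: S_def)
      then obtain y where "y \<in> \<Psi> ` sector \<theta> (inverse (real (Suc n)))" "dist y w < inverse (real (Suc n))"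
        unfolding closure_approachable by (meson inverse_positive_iff_positive of_nat_0_less_iff zero_less_Suc)
      then obtain r t where "r \<in> {1<..<1 + inverse (real (Suc n))}"
          "t \<in> {\<theta> - inverse (real (Suc n))<..<\<theta> + inverse (real (Suc n))}"
          "dist (\<Psi> (complex_of_real r * cis (2 * pi * t))) w < inverse (real (Suc n))"
        unfolding sector_def by force
      then show ?thesis
        by (intro exI[of _ r] exI[of _ t]) (auto simp: abs_less_iff)
    qed
    then obtain r t where rt: "\<And>n. 1 < r n" "\<And>n. r n < 1 + inverse (real (Suc n))"
        "\<And>n. \<bar>t n - \<theta>\<bar> < inverse (real (Suc n))"
        "\<And>n. dist (\<Psi> (complex_of_real (r n) * cis (2 * pi * t n))) w < inverse (real (Suc n))"
      by metis
    have "(\<lambda>n. r n - 1) \<longlonglongrightarrow> 0"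
      by (rule Lim_null_comparison[OF _ LIMSEQ_inverse_real_of_nat])
        (intro always_eventually allI, use rt(1,2) in \<open>smt (verit) real_norm_def\<close>)
    then have r: "r \<longlonglongrightarrow> 1"
      by (simp add: LIM_zero_iff)
    have "(\<lambda>n. t n - \<theta>) \<longlonglongrightarrow> 0"
      by (rule Lim_null_comparison[OF _ LIMSEQ_inverse_real_of_nat])
        (intro always_eventually allI, use rt(3) in \<open>simp add: less_imp_le\<close>)
    then have t: "t \<longlonglongrightarrow> \<theta>"
      by (simp add: LIM_zero_iff)
    have "(\<lambda>n. complex_of_real (r n) * cis (2 * pi * t n)) \<longlonglongrightarrow> complex_of_real 1 * cis (2 * pi * \<theta>)"
      by (intro tendsto_intros r t)
    moreover have "(\<lambda>n. \<Psi> (complex_of_real (r n) * cis (2 * pi * t n))) \<longlonglongrightarrow> w"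
      by (rule tendsto_dist_iff[THEN iffD2], rule Lim_null_comparison[OF _ LIMSEQ_inverse_real_of_nat])
        (intro always_eventually allI, use rt(4) in \<open>simp add: less_imp_le\<close>)
    moreover have "1 < cmod (complex_of_real (r n) * cis (2 * pi * t n))" for n
      using rt(1)[of n] by (simp add: norm_mult)
    ultimately show "w \<in> impression \<Psi> \<theta>"
      unfolding impression_def
      by (intro CollectI exI[of _ "\<lambda>n. complex_of_real (r n) * cis (2 * pi * t n)"]) simp
  next
    fix w assume "w \<in> impression \<Psi> \<theta>"
    then have "w \<in> S n" for n
      unfolding S_def using impression_subset_closure_sector[of "inverse (real (Suc n))" \<theta>] by auto
    then show "w \<in> \<Inter>(range S)"
      by blast
  qed
  moreover obtain M where M: "M > 1" "bounded (\<Psi> ` {z. 1 < cmod z \<and> cmod z < M})"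
    using map_bounded_near_circle by blast
  \<comment> \<open>From index \<open>k\<close> on the sectors lie inside the annulus on which
    \<open>\<Psi>\<close> is bounded.\<close>
  obtain k where k: "inverse (real (Suc k)) < M - 1"
    using reals_Archimedean[of "M - 1"] M(1) by auto
  have "bounded (\<Psi> ` sector \<theta> (inverse (real (Suc k))))"
    using sector_subset[of \<theta> "inverse (real (Suc k))"] k by (intro bounded_subset[OF M(2)] image_mono) auto
  then have "compact (S k)"
    by (simp add: S_def compact_closure)
  then have "connected (\<Inter>(range S))"
  proof (rule connected_nest_gen[rotated 2])
    fix m n :: nat assume "m \<le> n"
    then have le: "inverse (real (Suc n)) \<le> inverse (real (Suc m))"
      by (simp add: field_simps)
    then show "S n \<subseteq> S m"
      unfolding S_def by (intro closure_mono image_mono sector_mono)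
  qed (auto simp: S_def connected_sector_image connected_imp_connected_closure)
  ultimately show ?thesis
    by simp
qed

text \<open>Along a ray the values stay bounded near the circle, so Bolzano-Weierstrass gives an
  accumulation point, which also lies in the impression. This provides nonempty impressions and ties
  an angle of a ray-compactum to an actual point of it.\<close>

lemma acc_set_meets_impression: "acc_set \<Psi> \<theta> \<inter> impression \<Psi> \<theta> \<noteq> {}"
proof -
  obtain M where M: "M > 1" "bounded (\<Psi> ` {z. 1 < cmod z \<and> cmod z < M})"
    using map_bounded_near_circle by blast
  \<comment> \<open>The radii decrease to 1; the double \<open>Suc\<close> keeps even
    \<open>r 0\<close> strictly below \<open>M\<close>.\<close>
  define r where "r n = 1 + (M - 1) * inverse (real (Suc (Suc n)))" for n
  define z where "z n = complex_of_real (r n) * cis (2 * pi * \<theta>)" for n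
  have r1: "1 < r n" for n
    using M(1) by (simp add: r_def)
  have rM: "r n < M" for n
  proof -
    have "(M - 1) * inverse (real (Suc (Suc n))) < (M - 1) * 1"
      using M(1) by (intro mult_strict_left_mono) (auto simp: field_simps)
    then show ?thesis
      by (simp add: r_def)
  qed
  have zr: "cmod (z n) = r n" for n
    using r1[of n] by (simp add: z_def norm_mult)
  have "(\<lambda>n. inverse (real (Suc (Suc n)))) \<longlonglongrightarrow> 0"
    using LIMSEQ_Suc[OF LIMSEQ_inverse_real_of_nat] .
  then have "r \<longlonglongrightarrow> 1 + (M - 1) * 0"
    unfolding r_def by (intro tendsto_intros)
  then have r: "r \<longlonglongrightarrow> 1"
    by simp
  have "bounded (range (\<lambda>n. \<Psi> (z n)))"
    using zr r1 rM by (intro bounded_subset[OF M(2)]) auto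
  then obtain w k where k: "strict_mono k" "((\<lambda>n. \<Psi> (z n)) \<circ> k) \<longlonglongrightarrow> w"
    using bounded_imp_convergent_subsequence by blast
  have rk: "(r \<circ> k) \<longlonglongrightarrow> 1"
    using LIMSEQ_subseq_LIMSEQ[OF r k(1)] .
  have "(\<lambda>n. z (k n)) \<longlonglongrightarrow> complex_of_real 1 * cis (2 * pi * \<theta>)"
    unfolding z_def using rk by (intro tendsto_intros) (simp add: o_def)
  then have "w \<in> impression \<Psi> \<theta>"
    unfolding impression_def using k(2) r1
    by (auto simp: o_def zr intro!: exI[of _ "\<lambda>n. z (k n)"])
  moreover have "w \<in> acc_set \<Psi> \<theta>"
    unfolding acc_set_def
  proof (intro CollectI allI impI, elim conjE)
    fix U :: "complex set" assume U: "open U" "w \<in> U"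
    show "\<exists>\<^sub>F s in at_right 1. \<Psi> (complex_of_real s * cis (2 * pi * \<theta>)) \<in> U"
      unfolding frequently_def
    proof
      assume "\<forall>\<^sub>F s in at_right 1. \<Psi> (complex_of_real s * cis (2 * pi * \<theta>)) \<notin> U"
      moreover have "filterlim (r \<circ> k) (at_right 1) sequentially"
        using rk r1 by (auto simp: filterlim_at intro!: always_eventually less_imp_neq[symmetric])
      ultimately have "\<forall>\<^sub>F n in sequentially. \<Psi> (z (k n)) \<notin> U"
        unfolding z_def by (auto simp: filterlim_iff)
      moreover have "\<forall>\<^sub>F n in sequentially. \<Psi> (z (k n)) \<in> U"
        using topological_tendstoD[OF k(2) U] by simp
      ultimately have "\<forall>\<^sub>F n::nat in sequentially. False"
        by eventually_elim simp
      then show False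
        by simp
    qed
  qed
  ultimately show ?thesis
    by blast
qed

text \<open>A map that is constant on impressions induces a map of the circle of angles: both are
  quotients of the compact set of pairs (angle, point of its impression).\<close>

lemma locally_connected_image:
  fixes \<psi> :: "complex \<Rightarrow> 'b::metric_space"
  assumes \<psi>: "continuous_on Q \<psi>"
    and const: "\<And>\<theta> x y. \<lbrakk>x \<in> impression \<Psi> \<theta>; y \<in> impression \<Psi> \<theta>\<rbrakk> \<Longrightarrow> \<psi> x = \<psi> y"
  shows "locally connected (\<psi> ` Q)"
proof -
  define \<Gamma> where "\<Gamma> = ({-1..1::real} \<times> Q) \<inter> (\<lambda>(\<theta>, w). (cis (2 * pi * \<theta>), w)) -` closure map_graph"
  have "continuous_on UNIV (\<lambda>(\<theta>, w::complex). (cis (2 * pi * \<theta>), w))"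
    unfolding case_prod_beta by (intro continuous_intros)
  then have "closed ((\<lambda>(\<theta>, w). (cis (2 * pi * \<theta>), w)) -` closure map_graph)"
    by (metis closed_vimage closed_closure)
  then have compact: "compact \<Gamma>"
    unfolding \<Gamma>_def by (intro compact_Int_closed compact_Times compact_Q) auto
  have \<Gamma>_iff: "(\<theta>, w) \<in> \<Gamma> \<longleftrightarrow> \<theta> \<in> {-1..1} \<and> w \<in> impression \<Psi> \<theta>" for \<theta> w
    using impression_subset[of \<theta>] by (auto simp: \<Gamma>_def impression_iff)
  define e where "e \<theta> = \<psi> (SOME x. x \<in> impression \<Psi> \<theta>)" for \<theta>
  have e: "e \<theta> = \<psi> x" if "x \<in> impression \<Psi> \<theta>" for \<theta> x
    unfolding e_def using const someI that by metis
  have nonempty: "\<exists>x. x \<in> impression \<Psi> \<theta>" for \<theta>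
    using acc_set_meets_impression by blast
  have fst: "fst ` \<Gamma> = {-1..1}"
  proof
    show "fst ` \<Gamma> \<subseteq> {-1..1}"
      by (auto simp: \<Gamma>_def)
    show "{-1..1} \<subseteq> fst ` \<Gamma>"
    proof
      fix \<theta> :: real assume "\<theta> \<in> {-1..1}"
      then obtain x where "(\<theta>, x) \<in> \<Gamma>"
        using \<Gamma>_iff[of \<theta>] nonempty[of \<theta>] by auto
      then show "\<theta> \<in> fst ` \<Gamma>"
        by (rule image_eqI[rotated]) simp
    qed
  qed
  have snd: "snd ` \<Gamma> = Q"
  proof
    show "snd ` \<Gamma> \<subseteq> Q"
      by (auto simp: \<Gamma>_def)
    show "Q \<subseteq> snd ` \<Gamma>"
    proof
      fix w assume "w \<in> Q"
      then obtain \<theta> where "\<theta> \<in> {-1..1}" "w \<in> impression \<Psi> \<theta>"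
        using impressions_cover by blast
      then have "(\<theta>, w) \<in> \<Gamma>"
        using \<Gamma>_iff by blast
      then show "w \<in> snd ` \<Gamma>"
        by (rule image_eqI[rotated]) simp
    qed
  qed
  have e_fst: "e (fst p) = \<psi> (snd p)" if "p \<in> \<Gamma>" for p
    using that \<Gamma>_iff[of "fst p" "snd p"] e by simp
  have e_image: "e ` {-1..1} = \<psi> ` Q"
    unfolding fst[symmetric] snd[symmetric] image_image using e_fst by auto
  have "locally connected (e ` {-1..1})"
  proof (rule locally_connected_quotient_image)
    show "locally connected {-1..1::real}"
      by (simp add: convex_imp_locally_connected)
    fix T assume T: "T \<subseteq> e ` {-1..1}"
    \<comment> \<open>Openness is carried from the angles up to \<open>\<Gamma>\<close> along
      \<open>fst\<close> and down to the image along \<open>\<psi>\<close> after \<open>snd\<close>;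
      on \<open>\<Gamma>\<close> this composite agrees with \<open>e\<close> after
      \<open>fst\<close>.\<close>
    have "openin (top_of_set {-1..1}) ({-1..1} \<inter> e -` T) \<longleftrightarrow>
        openin (top_of_set \<Gamma>) (\<Gamma> \<inter> fst -` ({-1..1} \<inter> e -` T))"
      using Abstract_Topology_2.continuous_imp_quotient_map[OF _ fst compact, of "{-1..1} \<inter> e -` T"]
      by (simp add: continuous_on_fst)
    also have "\<Gamma> \<inter> fst -` ({-1..1} \<inter> e -` T) = \<Gamma> \<inter> (\<lambda>p. \<psi> (snd p)) -` T"
      using e_fst fst by auto
    also have "openin (top_of_set \<Gamma>) (\<Gamma> \<inter> (\<lambda>p. \<psi> (snd p)) -` T) \<longleftrightarrow> openin (top_of_set (e ` {-1..1})) T"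
    proof (rule Abstract_Topology_2.continuous_imp_quotient_map[OF _ _ compact T])
      show "continuous_on \<Gamma> (\<lambda>p. \<psi> (snd p))"
        using snd by (intro continuous_on_compose2[OF \<psi>] continuous_intros) auto
      show "(\<lambda>p. \<psi> (snd p)) ` \<Gamma> = e ` {-1..1}"
        unfolding e_image snd[symmetric] by (simp add: image_image)
    qed
    finally show "openin (top_of_set {-1..1}) ({-1..1} \<inter> e -` T) \<longleftrightarrow>
        openin (top_of_set (e ` {-1..1})) T" .
  qed
  then show ?thesis
    using e_image by simp
qed

section \<open>Cuts along ray-compacta\<close>

text \<open>Values of \<open>\<Psi>\<close> avoid \<open>Q\<close>, hence the compactum. By
  injectivity a ray can meet the sector image only if its angle agrees modulo 1 with one from the
  avoided interval, and periodicity of the angle set excludes this.\<close>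

lemma ray_tilde_avoids_sector:
  assumes rc: "ray_compactum Q \<Psi> c" and avoid: "{\<theta>-\<epsilon><..<\<theta>+\<epsilon>} \<inter> snd c = {}"
  shows "\<Psi> ` sector \<theta> \<epsilon> \<inter> ray_tilde \<Psi> c = {}"
proof -
  have "fst c \<subseteq> Q" and per: "angle_set (snd c)"
    using rc by (auto simp: ray_compactum_def split: prod.splits)
  then have "\<Psi> ` sector \<theta> \<epsilon> \<inter> fst c = {}"
    using sector_subset[of \<theta> \<epsilon>] map_notin_Q by blast
  moreover have False
    if y: "y \<in> \<Psi> ` sector \<theta> \<epsilon>" "\<tau> \<in> snd c" "y \<in> ext_ray \<Psi> \<tau>" for y \<tau>
  proof -
    obtain r t where rt: "1 < r" "t \<in> {\<theta>-\<epsilon><..<\<theta>+\<epsilon>}" "y = \<Psi> (complex_of_real r * cis (2 * pi * t))"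
      using y(1) unfolding sector_def by force
    obtain s where s: "1 < s" "y = \<Psi> (complex_of_real s * cis (2 * pi * \<tau>))"
      using y(3) by (auto simp: ext_ray_def)
    have eq: "complex_of_real r * cis (2 * pi * t) = complex_of_real s * cis (2 * pi * \<tau>)"
      by (rule inj_onD[OF inj_on_map]) (use rt s in \<open>auto simp: norm_mult\<close>)
    have "cmod (complex_of_real r * cis (2 * pi * t)) = cmod (complex_of_real s * cis (2 * pi * \<tau>))"
      using eq by simp
    then have "r = s"
      using rt(1) s(1) by (simp add: norm_mult)
    then have "cis (2 * pi * t) = cis (2 * pi * \<tau>)"
      using eq rt(1) by simp
    then obtain n :: int where "2 * pi * t = 2 * pi * \<tau> + 2 * pi * n"
      using sin_cos_eq_iff[of "2 * pi * t" "2 * pi * \<tau>"] by (auto simp: complex_eq_iff)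
    then have "2 * pi * t = 2 * pi * (\<tau> + n)"
      by (simp add: algebra_simps)
    then have "t = \<tau> + n"
      by simp
    have shift_nat: "\<sigma> + real k \<in> snd c \<longleftrightarrow> \<sigma> \<in> snd c" for \<sigma> k
    proof (induction k)
      case (Suc k)
      have "\<sigma> + real (Suc k) = (\<sigma> + real k) + 1"
        by simp
      then show ?case
        using Suc per unfolding angle_set_def by metis
    qed simp
    have "t \<in> snd c"
    proof (cases "n \<ge> 0")
      case True
      then show ?thesis
        using shift_nat[of \<tau> "nat n"] y(2) \<open>t = \<tau> + n\<close> by simp
    next
      case False
      then show ?thesis
        using shift_nat[of t "nat (- n)"] y(2) \<open>t = \<tau> + n\<close> by simp
    qed
    then show False
      using rt(2) avoid by blast
  qed
  ultimately show ?thesis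
    unfolding ray_tilde_def by blast
qed

text \<open>An impression whose angle is not used by the ray-compactum is approached through a sector of
  rays that misses it, hence lies on one side.\<close>

lemma ray_separates_split:
  assumes rc: "ray_compactum Q \<Psi> c" and sep: "ray_separates Q \<Psi> c A B" and AB: "A \<subseteq> Q" "B \<subseteq> Q"
  obtains U V where "openin (top_of_set Q) U" "openin (top_of_set Q) V" "U \<inter> V = {}"
    "U \<union> V = Q - fst c" "A \<subseteq> U" "B \<subseteq> V"
    "\<And>\<theta>. \<theta> \<notin> snd c \<Longrightarrow> impression \<Psi> \<theta> \<inter> V = {} \<or> impression \<Psi> \<theta> \<inter> U = {}"
proof -
  obtain U V where UV: "closure (outside Q) - ray_tilde \<Psi> c = U \<union> V" "A \<subseteq> U" "B \<subseteq> V"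
      "closure U \<inter> V = {}" "U \<inter> closure V = {}"
    using sep by (auto simp: ray_separates_def)
  have "compact (fst c)" "fst c \<subseteq> Q" "closed (snd c)"
    using rc by (auto simp: ray_compactum_def split: prod.splits)
  have "ext_ray \<Psi> \<theta> \<inter> Q = {}" for \<theta>
    using map_notin_Q by (auto simp: ext_ray_def norm_mult)
  then have tilde_Q: "ray_tilde \<Psi> c \<inter> Q = fst c"
    using \<open>fst c \<subseteq> Q\<close> by (auto simp: ray_tilde_def)
  have Q_closure: "Q \<subseteq> closure (outside Q)"
    using Q_eq by blast
  have closed: "closed (fst c)"
    using \<open>compact (fst c)\<close> by (rule compact_imp_closed)
  have un: "(Q \<inter> U) \<union> (Q \<inter> V) = Q - fst c"
    using UV(1) tilde_Q Q_closure by blast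
  have disj: "U \<inter> V = {}"
    using UV(4) closure_subset by blast
  \<comment> \<open>Each side is the rest of \<open>Q\<close> after removing the compactum and the
    closure of the other side, hence relatively open.\<close>
  have "Q \<inter> U = Q \<inter> - (fst c \<union> closure V)" "Q \<inter> V = Q \<inter> - (fst c \<union> closure U)"
    using un UV(4,5) closure_subset[of V] closure_subset[of U] by blast+
  then have opn: "openin (top_of_set Q) (Q \<inter> U)" "openin (top_of_set Q) (Q \<inter> V)"
    using closed by (metis closed_Un closed_closure open_Compl openin_open_Int)+
  have side: "impression \<Psi> \<theta> \<inter> V = {} \<or> impression \<Psi> \<theta> \<inter> U = {}" if "\<theta> \<notin> snd c" for \<theta>
  proof -
    obtain \<epsilon> where \<epsilon>: "\<epsilon> > 0" "ball \<theta> \<epsilon> \<subseteq> - snd c"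
      using \<open>closed (snd c)\<close> \<open>\<theta> \<notin> snd c\<close> open_contains_ball[of "- snd c"] by auto
    define W where "W = \<Psi> ` sector \<theta> \<epsilon>"
    have "{\<theta>-\<epsilon><..<\<theta>+\<epsilon>} \<inter> snd c = {}"
      using \<epsilon>(2) by (auto simp: ball_eq_greaterThanLessThan)
    then have "W \<inter> ray_tilde \<Psi> c = {}"
      unfolding W_def by (rule ray_tilde_avoids_sector[OF rc])
    moreover have "W \<subseteq> closure (outside Q)"
      using sector_subset[of \<theta> \<epsilon>] map_in_outside closure_subset unfolding W_def by blast
    ultimately have WUV: "W \<subseteq> U \<union> V"
      using UV(1) by blast
    have "connected W"
      unfolding W_def by (rule connected_sector_image)
    then have "W \<inter> U = {} \<or> W \<inter> V = {}"
      using WUV UV(4,5) closure_subset[of U] closure_subset[of V]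
        connected_closedD[of W "closure U" "closure V"] by blast
    then have "W \<subseteq> V \<or> W \<subseteq> U"
      using WUV by blast
    then have "closure W \<inter> V = {} \<or> closure W \<inter> U = {}"
      using UV(4,5) closure_mono[of W U] closure_mono[of W V] by blast
    then show ?thesis
      using impression_subset_closure_sector[OF \<epsilon>(1), of \<theta>] unfolding W_def by blast
  qed
  show thesis
    using that[of "Q \<inter> U" "Q \<inter> V"] opn un disj UV(2,3) AB side by blast
qed

text \<open>Were the compactum disjoint from \<open>X\<close>, the two relatively open sides would
  disconnect \<open>X\<close>, each containing one of the separated points.\<close>

lemma ray_separates_continuum_meets:
  assumes "ray_compactum Q \<Psi> c" "ray_separates_continuum Q \<Psi> c X" "connected X" "X \<subseteq> Q"
  shows "X \<inter> fst c \<noteq> {}"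
proof
  assume empty: "X \<inter> fst c = {}"
  obtain x y where xy: "x \<in> X" "y \<in> X" "ray_separates Q \<Psi> c {x} {y}"
    using assms(2) by (auto simp: ray_separates_continuum_def)
  obtain U V where UV: "openin (top_of_set Q) U" "openin (top_of_set Q) V" "U \<inter> V = {}"
      "U \<union> V = Q - fst c" "{x} \<subseteq> U" "{y} \<subseteq> V"
    by (rule ray_separates_split[OF assms(1) xy(3)]) (use xy assms(4) in auto)
  obtain U' V' where "open U'" "open V'" "U = Q \<inter> U'" "V = Q \<inter> V'"
    using UV(1,2) by (auto simp: openin_open)
  then show False
    using connectedD[OF assms(3), of U' V'] UV xy empty assms(4) by blast
qed

text \<open>The ray-compactum itself may stick out on both sides, so a cut keeps only the part of it in
  \<open>F - G\<close>; the last conjunct says that only impressions of its own angles can cross it.\<close>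

definition cut :: "(complex set \<times> real set) \<times> complex set \<times> complex set \<Rightarrow> bool" where
  "cut = (\<lambda>(c, G, F). openin (top_of_set Q) G \<and> closedin (top_of_set Q) F \<and> G \<subseteq> F \<and> F - G \<subseteq> fst c \<and>
     (\<forall>\<theta>. \<theta> \<notin> snd c \<longrightarrow> impression \<Psi> \<theta> \<subseteq> F \<or> impression \<Psi> \<theta> \<inter> G = {}))"

text \<open>The side \<open>U\<close> of the new compactum, truncated between the two old cuts, is
  the new cut. The inclusions hold because \<open>F - G\<close> lies in \<open>fst p\<close>, which
  is inside \<open>U\<close>, and \<open>F' - G'\<close> lies in \<open>fst q\<close>, which is
  inside \<open>V\<close>.\<close>

lemma cut_between:
  assumes rc: "ray_compactum Q \<Psi> p" "ray_compactum Q \<Psi> q" "ray_compactum Q \<Psi> r"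
    and cuts: "cut (p, G, F)" "cut (q, G', F')" and FG: "F \<subseteq> G'"
    and sep: "ray_separates Q \<Psi> r (fst p) (fst q)"
  obtains G'' F'' where "cut (r, G'', F'')" "F \<subseteq> G''" "F'' \<subseteq> G'"
proof -
  have pq: "fst p \<subseteq> Q" "fst q \<subseteq> Q"
    using rc by (auto simp: ray_compactum_def split: prod.splits)
  obtain U V where UV: "openin (top_of_set Q) U" "openin (top_of_set Q) V" "U \<inter> V = {}"
      "U \<union> V = Q - fst r" "fst p \<subseteq> U" "fst q \<subseteq> V"
      "\<And>\<theta>. \<theta> \<notin> snd r \<Longrightarrow> impression \<Psi> \<theta> \<inter> V = {} \<or> impression \<Psi> \<theta> \<inter> U = {}"
    by (rule ray_separates_split[OF rc(3) sep pq], rule that)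
  have 1: "openin (top_of_set Q) G" "closedin (top_of_set Q) F" "G \<subseteq> F" "F - G \<subseteq> fst p"
      "\<And>\<theta>. \<theta> \<notin> snd p \<Longrightarrow> impression \<Psi> \<theta> \<subseteq> F \<or> impression \<Psi> \<theta> \<inter> G = {}"
    using cuts(1) unfolding cut_def by auto
  have 2: "openin (top_of_set Q) G'" "closedin (top_of_set Q) F'" "G' \<subseteq> F'" "F' - G' \<subseteq> fst q"
      "\<And>\<theta>. \<theta> \<notin> snd q \<Longrightarrow> impression \<Psi> \<theta> \<subseteq> F' \<or> impression \<Psi> \<theta> \<inter> G' = {}"
    using cuts(2) unfolding cut_def by auto
  define G'' where "G'' = (U \<inter> G') \<union> G"
  define F'' where "F'' = ((Q - V) \<inter> F') \<union> F"
  have "closedin (top_of_set Q) (Q - V)"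
    using UV(2) by (simp add: openin_closedin_eq)
  have QV: "Q - V \<subseteq> U \<union> fst r"
    using UV(4) by blast
  \<comment> \<open>By contraposition, an impression missing \<open>V\<close> has its angle outside
    \<open>snd q\<close>, and one missing \<open>U\<close> has it outside \<open>snd p\<close>. So
    the crossing condition of the corresponding old cut is available.\<close>
  have acc: "impression \<Psi> \<theta> \<inter> fst c \<noteq> {}" if "ray_compactum Q \<Psi> c" "\<theta> \<in> snd c" for c \<theta>
    using acc_set_meets_impression[of \<theta>] that by (fastforce simp: ray_compactum_def split: prod.splits)
  have "F \<subseteq> G''"
    using 1(4) UV(5) FG by (auto simp: G''_def)
  moreover have "F'' \<subseteq> G'"
    using 2(4) UV(6) FG by (auto simp: F''_def)
  moreover have "F'' - G'' \<subseteq> fst r"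
  proof
    fix x assume x: "x \<in> F'' - G''"
    then have "x \<notin> F"
      using \<open>F \<subseteq> G''\<close> by blast
    then have "x \<in> Q - V" "x \<in> G'"
      using x \<open>F'' \<subseteq> G'\<close> by (auto simp: F''_def)
    then show "x \<in> fst r"
      using x QV by (auto simp: G''_def)
  qed
  moreover have "G'' \<subseteq> F''"
    using UV(3) 1(3) 2(3) openin_imp_subset[OF UV(1)] by (auto simp: G''_def F''_def)
  moreover have "openin (top_of_set Q) G''"
    unfolding G''_def by (intro openin_Un openin_Int UV 1 2)
  moreover have "closedin (top_of_set Q) F''"
    unfolding F''_def by (intro closedin_Un closedin_Int 1 2 \<open>closedin (top_of_set Q) (Q - V)\<close>)
  moreover have "impression \<Psi> \<theta> \<subseteq> F'' \<or> impression \<Psi> \<theta> \<inter> G'' = {}" if \<theta>: "\<theta> \<notin> snd r" for \<theta>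
    using UV(7)[OF \<theta>]
  proof
    assume low: "impression \<Psi> \<theta> \<inter> V = {}"
    then have "\<theta> \<notin> snd q"
      using acc[OF rc(2)] UV(6) by blast
    then show ?thesis
      using 2(5)[of \<theta>] low impression_subset[of \<theta>] 1(3) FG by (auto simp: G''_def F''_def)
  next
    assume high: "impression \<Psi> \<theta> \<inter> U = {}"
    then have "\<theta> \<notin> snd p"
      using acc[OF rc(1)] UV(5) by blast
    then show ?thesis
      using 1(5)[of \<theta>] high by (auto simp: G''_def F''_def)
  qed
  ultimately show thesis
    by (intro that[of G'' F'']) (auto simp: cut_def)
qed

section \<open>The Urysohn function of a well-slicing family\<close>

lemma well_slicing_function:
  assumes ws: "well_slicing Q \<Psi> \<C> X" and X: "connected X" "X \<subseteq> Q"
  obtains f :: "complex \<Rightarrow> real" where "continuous_on Q f"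
    "\<And>\<theta> x y. \<lbrakk>x \<in> impression \<Psi> \<theta>; y \<in> impression \<Psi> \<theta>\<rbrakk> \<Longrightarrow> f x = f y"
    "\<exists>x\<in>X. \<exists>y\<in>X. f x \<noteq> f y"
proof -
  have rc: "ray_compactum Q \<Psi> c" and meets: "X \<inter> fst c \<noteq> {}" if "c \<in> \<C>" for c
    using ws that ray_separates_continuum_meets[OF _ _ X] by (auto simp: well_slicing_def)
  have disj: "fst c \<inter> fst c' = {}" if "c \<in> \<C>" "c' \<in> \<C>" "c \<noteq> c'" for c c'
    using ws that by (auto simp: well_slicing_def)
  have third: "\<exists>c''\<in>\<C>. c'' \<noteq> c \<and> c'' \<noteq> c' \<and> ray_separates Q \<Psi> c'' (fst c) (fst c')"
    if "c \<in> \<C>" "c' \<in> \<C>" "c \<noteq> c'" for c c'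
    using ws that unfolding well_slicing_def by blast
  obtain c0 c1 where c01: "c0 \<in> \<C>" "c1 \<in> \<C>" "c0 \<noteq> c1"
    using ws unfolding well_slicing_def by blast
  have angles_disj: "\<theta> \<notin> snd c'" if "c \<in> \<C>" "c' \<in> \<C>" "c \<noteq> c'" "\<theta> \<in> snd c" for c c' \<theta>
  proof
    assume "\<theta> \<in> snd c'"
    then have "acc_set \<Psi> \<theta> \<subseteq> fst c" "acc_set \<Psi> \<theta> \<subseteq> fst c'"
      using rc[OF that(1)] rc[OF that(2)] that(4)
      by (auto simp: ray_compactum_def split: prod.splits)
    then show False
      using disj[OF that(1,2,3)] acc_set_meets_impression[of \<theta>] by blast
  qed
  define S where "S = (\<lambda>(c, G, F) (c', G', F'). c \<in> \<C> \<and> c' \<in> \<C> \<and> c \<noteq> c' \<and>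
    cut (c, G, F) \<and> cut (c', G', F') \<and> F \<subseteq> G')"
  define crosses where "crosses = (\<lambda>\<theta> (c :: complex set \<times> real set, G, F).
    impression \<Psi> \<theta> \<inter> G \<noteq> {} \<and> \<not> impression \<Psi> \<theta> \<subseteq> F)"
  \<comment> \<open>\<open>S\<close> need not be transitive, since the two ends of a chain may use
    the same member of the family. The dyadic recursion needs a transitive dense relation, hence the
    transitive closure.\<close>
  define R where "R = S\<^sup>+\<^sup>+"
  have S_dense: "\<exists>z. S x z \<and> S z y" if "S x y" for x y
  proof -
    obtain c G F c' G' F' where xy: "x = (c, G, F)" "y = (c', G', F')"
      by (metis prod_cases3)
    then have S: "c \<in> \<C>" "c' \<in> \<C>" "c \<noteq> c'" "cut (c, G, F)" "cut (c', G', F')" "F \<subseteq> G'"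
      using that by (auto simp: S_def)
    obtain d where d: "d \<in> \<C>" "d \<noteq> c" "d \<noteq> c'" "ray_separates Q \<Psi> d (fst c) (fst c')"
      using third[OF S(1-3)] by blast
    obtain G'' F'' where "cut (d, G'', F'')" "F \<subseteq> G''" "F'' \<subseteq> G'"
      using cut_between[OF rc[OF S(1)] rc[OF S(2)] rc[OF d(1)] S(4,5,6) d(4)] by blast
    then show ?thesis
      using S d unfolding xy by (intro exI[of _ "(d, G'', F'')"]) (auto simp: S_def)
  qed
  have R_dense: "\<exists>z. R x z \<and> R z y" if "R x y" for x y
    using that unfolding R_def
    by (cases rule: tranclp.cases) (use S_dense in blast)+
  have S_props: "cut x \<and> cut y \<and> snd (snd x) \<subseteq> fst (snd y) \<and> (\<forall>\<theta>. \<not> (crosses \<theta> x \<and> crosses \<theta> y))"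
    if "S x y" for x y
  proof -
    obtain c G F c' G' F' where xy: "x = (c, G, F)" "y = (c', G', F')"
      by (metis prod_cases3)
    then have S: "c \<in> \<C>" "c' \<in> \<C>" "c \<noteq> c'" "cut (c, G, F)" "cut (c', G', F')" "F \<subseteq> G'"
      using that by (auto simp: S_def)
    have "\<not> (crosses \<theta> x \<and> crosses \<theta> y)" for \<theta>
      using angles_disj[OF S(1-3), of \<theta>] S(4,5) unfolding xy crosses_def cut_def prod.case by metis
    then show ?thesis
      using S(4-6) by (simp add: xy)
  qed
  have R_props: "cut x \<and> cut y \<and> snd (snd x) \<subseteq> fst (snd y) \<and> (\<forall>\<theta>. \<not> (crosses \<theta> x \<and> crosses \<theta> y))"
    if "R x y" for x y
    using that unfolding R_def
  proof induction
    case (base y)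
    then show ?case
      by (rule S_props)
  next
    case (step y z)
    note yz = S_props[OF step.hyps(2)]
    have "fst (snd y) \<subseteq> snd (snd y)" "fst (snd x) \<subseteq> snd (snd x)" "fst (snd z) \<subseteq> snd (snd z)"
      using step.IH yz by (auto simp: cut_def)
    then have xy: "fst (snd x) \<subseteq> fst (snd y)" and yz': "snd (snd y) \<subseteq> snd (snd z)"
        and xz: "snd (snd x) \<subseteq> fst (snd z)"
      using step.IH yz by auto
    \<comment> \<open>An impression crossing both outer cuts must cross the middle one, and
      \<open>y\<close>, \<open>z\<close> are adjacent under \<open>S\<close>, where a double
      crossing would put the angle into two distinct members.\<close>
    have "crosses \<theta> y" if "crosses \<theta> x" "crosses \<theta> z" for \<theta>
      using that xy yz' unfolding crosses_def case_prod_beta by blast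
    then show ?case
      using step.IH yz xz by blast
  qed
  have sub: "fst c \<subseteq> Q" and "compact (fst c)" if "c \<in> \<C>" for c
    using rc[OF that] by (auto simp: ray_compactum_def split: prod.splits)
  then have closed: "closedin (top_of_set Q) (fst c)" if "c \<in> \<C>" for c
    using that by (simp add: closed_subset compact_imp_closed)
  \<comment> \<open>These extreme cuts make \<open>F 0\<close> equal to \<open>fst c0\<close> and
    the part of \<open>Q\<close> outside \<open>G 1\<close> equal to \<open>fst c1\<close>. Both
    satisfy the crossing condition trivially.\<close>
  have "R (c0, {}, fst c0) (c1, Q - fst c1, Q)"
    unfolding R_def
  proof (rule tranclp.r_into_trancl)
    show "S (c0, {}, fst c0) (c1, Q - fst c1, Q)"
      using c01 closed[OF c01(1)] closed[OF c01(2)] sub[OF c01(1)] disj[OF c01] impression_subset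
      by (auto simp: S_def cut_def closedin_def)
  qed
  then have "\<exists>t. t 0 = (c0, {}, fst c0) \<and> t 1 = (c1, Q - fst c1, Q) \<and>
      (\<forall>p \<in> dyadics \<inter> {0..1::real}. \<forall>q \<in> dyadics \<inter> {0..1}. p < q \<longrightarrow> R (t p) (t q))"
  proof (rule recursion_on_dyadic_fractions)
    show "\<And>x y z. R x y \<Longrightarrow> R y z \<Longrightarrow> R x z"
      unfolding R_def by (rule tranclp_trans)
  qed (rule R_dense)
  then obtain t where t: "t 0 = (c0, {}, fst c0)" "t 1 = (c1, Q - fst c1, Q)"
      "\<And>p q. \<lbrakk>p \<in> dyadics \<inter> {0..1::real}; q \<in> dyadics \<inter> {0..1}; p < q\<rbrakk> \<Longrightarrow> R (t p) (t q)"
    by blast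
  define G where "G q = fst (snd (t q))" for q
  define F where "F q = snd (snd (t q))" for q
  have 01: "0 \<in> dyadics \<inter> {0..1::real}" "1 \<in> dyadics \<inter> {0..1::real}"
    using real_in_dyadics[of 0] real_in_dyadics[of 1] by auto
  have cut: "cut (t q)" if "q \<in> dyadics \<inter> {0..1}" for q
  proof (cases "q = 1")
    case True
    then show ?thesis
      using R_props[OF t(3)[OF 01]] by simp
  next
    case False
    then show ?thesis
      using R_props[OF t(3)[OF that 01(2)]] that by simp
  qed
  have GF: "openin (top_of_set Q) (G q)" "closedin (top_of_set Q) (F q)" "G q \<subseteq> F q"
    if "q \<in> dyadics \<inter> {0..1}" for q
    using cut[OF that] by (auto simp: cut_def G_def F_def split: prod.splits)
  have FG: "F p \<subseteq> G q" if "p \<in> dyadics \<inter> {0..1}" "q \<in> dyadics \<inter> {0..1}" "p < q" for p q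
    using R_props[OF t(3)[OF that]] by (simp add: G_def F_def)
  obtain f :: "complex \<Rightarrow> real" where f: "continuous_on Q f" "\<And>x. 0 \<le> f x" "\<And>x. f x \<le> 1"
      "\<And>x. x \<in> F 0 \<Longrightarrow> f x = 0" "\<And>x. x \<notin> G 1 \<Longrightarrow> f x = 1"
      "\<And>x q. \<lbrakk>q \<in> dyadics \<inter> {0..1}; f x < q\<rbrakk> \<Longrightarrow> x \<in> G q"
      "\<And>x q. \<lbrakk>q \<in> dyadics \<inter> {0..1}; q < f x\<rbrakk> \<Longrightarrow> x \<notin> F q"
    using Urysohn_function_of_dyadic_chain[of Q G F, OF GF FG] by blast
  have not_less: "\<not> f x < f y" if imp: "x \<in> impression \<Psi> \<theta>" "y \<in> impression \<Psi> \<theta>" for x y \<theta>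
  proof
    assume less: "f x < f y"
    \<comment> \<open>A single crossing is possible for an angle of the member itself, so two levels
      are taken: crossing both related cuts is excluded.\<close>
    obtain p where p: "p \<in> dyadics \<inter> {0..1}" "f x < p" "p < f y"
      using dyadics_dense_unit_interval[OF f(2) less f(3)] by blast
    obtain q where q: "q \<in> dyadics \<inter> {0..1}" "p < q" "q < f y"
      using dyadics_dense_unit_interval[of p "f y"] p f(3) by auto
    have "crosses \<theta> (t s)" if s: "s \<in> dyadics \<inter> {0..1}" "f x < s" "s < f y" for s
      using f(6)[OF s(1,2)] f(7)[OF s(1,3)] imp
      by (auto simp: crosses_def G_def F_def split: prod.splits)
    then show False
      using R_props[OF t(3)[OF p(1) q(1,2)]] p q by (meson less_trans)
  qed
  have const: "f x = f y" if "x \<in> impression \<Psi> \<theta>" "y \<in> impression \<Psi> \<theta>" for \<theta> x y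
    using not_less[OF that] not_less[OF that(2,1)] by simp
  obtain x y where "x \<in> X" "x \<in> fst c0" "y \<in> X" "y \<in> fst c1"
    using meets[OF c01(1)] meets[OF c01(2)] by blast
  then have "f x = 0" "f y = 1"
    using f(4)[of x] f(5)[of y] by (auto simp: F_def G_def t(1,2))
  then have "\<exists>x\<in>X. \<exists>y\<in>X. f x \<noteq> f y"
    using \<open>x \<in> X\<close> \<open>y \<in> X\<close> by (metis zero_neq_one)
  then show thesis
    using that[OF f(1)] const by blast
qed

text \<open>The fibres of \<open>\<psi>\<close> are the components of the level sets of
  \<open>f\<close>. An impression is connected and lies in one level set, so \<open>\<psi>\<close>
  is constant on it and the image inherits local connectedness from the angles.\<close>

lemma locally_connected_monotone_quotient:
  fixes f :: "complex \<Rightarrow> real"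
  assumes f: "continuous_on Q f"
    and const: "\<And>\<theta> x y. \<lbrakk>x \<in> impression \<Psi> \<theta>; y \<in> impression \<Psi> \<theta>\<rbrakk> \<Longrightarrow> f x = f y"
  obtains \<psi> :: "complex \<Rightarrow> nat \<Rightarrow> real" where "lc_continuum (\<psi> ` Q)" "monotone_onto \<psi> Q (\<psi> ` Q)"
    "\<And>x y. \<lbrakk>x \<in> Q; y \<in> Q; \<psi> x = \<psi> y\<rbrakk> \<Longrightarrow> f x = f y"
proof -
  obtain \<psi> :: "complex \<Rightarrow> nat \<Rightarrow> real" where \<psi>: "continuous_on Q \<psi>"
      "\<And>x y. \<lbrakk>x \<in> Q; y \<in> Q\<rbrakk> \<Longrightarrow> \<psi> x = \<psi> y \<longleftrightarrow> connected_component {z\<in>Q. f z = f x} x y"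
    by (rule monotone_light_factorization[OF compact_Q f]) blast
  have "\<psi> x = \<psi> y" if xy: "x \<in> impression \<Psi> \<theta>" "y \<in> impression \<Psi> \<theta>" for x y \<theta>
  proof -
    have "impression \<Psi> \<theta> \<subseteq> {z\<in>Q. f z = f x}"
      using const[OF _ xy(1)] impression_subset[of \<theta>] by blast
    then have "connected_component {z\<in>Q. f z = f x} x y"
      unfolding connected_component_def using connected_impression[of \<theta>] xy by blast
    then show ?thesis
      using \<psi>(2) xy impression_subset[of \<theta>] by blast
  qed
  then have lc: "locally connected (\<psi> ` Q)"
    by (rule locally_connected_image[OF \<psi>(1)])
  have continuum: "continuum (\<psi> ` Q)"
    using continuum_Q \<psi>(1) by (auto simp: continuum_def compact_continuous_image connected_continuous_image)
  have fibres: "connected {x\<in>Q. \<psi> x = y}" if y: "y \<in> \<psi> ` Q" for y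
  proof -
    obtain x0 where x0: "x0 \<in> Q" "y = \<psi> x0"
      using y by blast
    have "connected_component {z\<in>Q. f z = f x0} x0 x \<Longrightarrow> x \<in> Q" for x
      by (metis (mono_tags, lifting) connected_component_in mem_Collect_eq)
    then have "{x\<in>Q. \<psi> x = y} = connected_component_set {z\<in>Q. f z = f x0} x0"
      using \<psi>(2)[OF x0(1)] x0(2) by (metis (mono_tags, lifting) Collect_cong)
    then show ?thesis
      by simp
  qed
  have factor: "f x = f y" if "x \<in> Q" "y \<in> Q" "\<psi> x = \<psi> y" for x y
  proof -
    have "connected_component {z\<in>Q. f z = f x} x y"
      using \<psi>(2) that by blast
    then show ?thesis
      by (metis (mono_tags, lifting) connected_component_in mem_Collect_eq)
  qed
  show thesis
  proof (rule that)
    show "lc_continuum (\<psi> ` Q)"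
      using lc continuum by (simp add: lc_continuum_def)
    show "monotone_onto \<psi> Q (\<psi> ` Q)"
      using \<psi>(1) fibres by (simp add: monotone_onto_def)
  qed (rule factor)
qed

end

section \<open>Factoring through the finest map\<close>

theorem theorem3p15:
  fixes Q X :: "complex set" and \<Psi> :: "complex \<Rightarrow> complex"
    and \<phi> :: "complex \<Rightarrow> 'a::metric_space" and Y :: "'a set"
    and \<C> :: "(complex set \<times> real set) set"
  assumes "continuum Q" and "unshielded Q"
    and "riemann_map_ext Q \<Psi>"
    and "finest_map Q \<phi> Y"
    and "continuum X" and "X \<subseteq> Q"
    and "well_slicing Q \<Psi> \<C> X"
  shows "\<not> (\<exists>y. \<phi> ` X = {y})"
proof
  assume "\<exists>y. \<phi> ` X = {y}"
  then have const: "\<phi> x = \<phi> y" if "x \<in> X" "y \<in> X" for x y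
    using that by (metis imageI singletonD)
  interpret exterior_map Q \<Psi>
    using assms by unfold_locales
  obtain f :: "complex \<Rightarrow> real" where f: "continuous_on Q f"
      "\<And>\<theta> x y. \<lbrakk>x \<in> impression \<Psi> \<theta>; y \<in> impression \<Psi> \<theta>\<rbrakk> \<Longrightarrow> f x = f y"
      "\<exists>x\<in>X. \<exists>y\<in>X. f x \<noteq> f y"
    using well_slicing_function[OF assms(7) _ assms(6)] assms(5) by (auto simp: continuum_def)
  obtain \<psi> :: "complex \<Rightarrow> nat \<Rightarrow> real" where \<psi>: "lc_continuum (\<psi> ` Q)" "monotone_onto \<psi> Q (\<psi> ` Q)"
      "\<And>x y. \<lbrakk>x \<in> Q; y \<in> Q; \<psi> x = \<psi> y\<rbrakk> \<Longrightarrow> f x = f y"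
    by (rule locally_connected_monotone_quotient[OF f(1)]) (use f(2) in blast)+
  \<comment> \<open>If \<open>\<phi>\<close> were constant on \<open>X\<close>, then so would be
    \<open>\<psi>\<close>, which factors through it, and hence \<open>f\<close>.\<close>
  obtain h where "\<And>x. x \<in> Q \<Longrightarrow> \<psi> x = h (\<phi> x)"
    using assms(4) \<psi>(1,2) unfolding finest_map_def by blast
  then show False
    using const \<psi>(3) f(3) assms(6) by (metis subsetD)
qed

end
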